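(* There are absolute constants $C_1,C_2>0$ such that for all $p\in[1,\infty]$ and all integers $n\geq 2$, the $n$-dimensional Bohr radius $\mathcal{R}^{\ast}_P(\mathbb{B}_{\ell_p^n})$ satisfies $$C_1\left(\frac1n\right)^{1-\frac{1}{\min\{p,2\}}}\leq\mathcal{R}^{\ast}_P(\mathbb{B}_{\ell_p^n})\leq C_2\left(\frac{\log n}{n}\right)^{1-\frac{1}{\min\{p,2\}}}.$$
   Context: For $p\in[1,\infty)$, $\|z\|_p=(\sum_j|z_j|^p)^{1/p}$, and $\|z\|_\infty=\max_j|z_j|$; $\mathbb{B}_{\ell_p^n}=\{z\in\mathbb{C}^n:\|z\|_p<1\}$ and $\rho\mathbb{B}_{\ell_p^n}=\{z\in\mathbb{C}^n:\|z\|_p<\rho\}$. Multi-indices $\alpha$ are $n$-tuples of nonnegative integers, $|\alpha|=\sum_k\alpha_k$, $z^\alpha=\prod_kz_k^{\alpha_k}$. A twice continuously differentiable complex-valued function $f$ on a domain $\Omega\subset\mathbb{C}^n$ is pluriharmonic if for each fixed $z\in\Omega$ and $\theta\in\mathbb{C}^n$ with $\|\theta\|_2=1$, $\zeta\mapsto f(z+\zeta\theta)$ is harmonic in $\{|\zeta|<d_\Omega(z)\}$, where $d_\Omega(z)$ is the Euclidean distance from $z$ to $\partial\Omega$. $\mathscr{PH}(\mathbb{B}_{\ell_p^n})$ is the set of all pluriharmonic functions from $\mathbb{B}_{\ell_p^n}$ into $\mathbb{C}$; each such $f$ equals $h+\overline g$ with $h=\sum_\alpha a_\alpha z^\alpha$,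 $g=\sum_\alpha b_\alpha z^\alpha$ holomorphic, written $f(z)=\sum_\alpha a_\alpha z^\alpha+\sum_\alpha\overline b_\alpha\overline z^\alpha$. $\mathcal{R}^{\ast}_P(\mathbb{B}_{\ell_p^n})$ is the largest number $\rho$ such that whenever $f(z)=\sum_\alpha a_\alpha z^\alpha+\sum_\alpha\overline{b}_\alpha\overline{z}^\alpha\in\mathscr{PH}(\mathbb{B}_{\ell_p^n})$ with $b_0=0$ and $\sup_{z\in\mathbb{B}_{\ell_p^n}}|f(z)|\leq1$, then $\sum_{k=1}^{\infty}\sum_{|\alpha|=k}(|a_\alpha|+|b_\alpha|)|z^\alpha|\leq 1$ for all $z\in\rho\mathbb{B}_{\ell_p^n}$. *)

theory Defs
  imports "HOL-Analysis.Analysis"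
begin

text \<open>
  The dimension \<open>n\<close> has to be quantified inside the statement (the constants must not depend on it),
  so points of \<open>\<complex>\<^sup>n\<close> are functions on the naturals vanishing from index \<open>n\<close> on. The topology on
  \<^typ>\<open>nat \<Rightarrow> complex\<close> is the product topology, which restricts to the Euclidean topology
  on this set.
\<close>

definition cspace :: "nat \<Rightarrow> (nat \<Rightarrow> complex) set" where
  "cspace n = {z. \<forall>j\<ge>n. z j = 0}"

definition lp_norm :: "nat \<Rightarrow> ereal \<Rightarrow> (nat \<Rightarrow> complex) \<Rightarrow> real" where
  "lp_norm n p z =
     (if p = \<infinity> then Max ((\<lambda>j. cmod (z j)) ` {..<n})
      else (\<Sum>j<n. cmod (z j) powr real_of_ereal p) powr (1 / real_of_ereal p))"

definition lp_ball :: "nat \<Rightarrow> ereal \<Rightarrow> real \<Rightarrow> (nat \<Rightarrow> complex) set" where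
  "lp_ball n p \<rho> = {z \<in> cspace n. lp_norm n p z < \<rho>}"

definition multi_indices :: "nat \<Rightarrow> (nat \<Rightarrow> nat) set" where
  "multi_indices n = {\<alpha>. \<forall>j\<ge>n. \<alpha> j = 0}"

definition mi_degree :: "nat \<Rightarrow> (nat \<Rightarrow> nat) \<Rightarrow> nat" where
  "mi_degree n \<alpha> = (\<Sum>j<n. \<alpha> j)"

definition mi_power :: "nat \<Rightarrow> (nat \<Rightarrow> complex) \<Rightarrow> (nat \<Rightarrow> nat) \<Rightarrow> complex" where
  "mi_power n z \<alpha> = (\<Prod>j<n. z j ^ \<alpha> j)"

text \<open>
  Real partial derivatives: with \<open>z\<^sub>j = x\<^sub>j + \<i> y\<^sub>j\<close>, the choices \<open>c = 1\<close> and \<open>c = \<i>\<close> give the derivatives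
  with respect to \<open>x\<^sub>j\<close> and \<open>y\<^sub>j\<close>.
\<close>

definition line_through ::
  "((nat \<Rightarrow> complex) \<Rightarrow> complex) \<Rightarrow> nat \<Rightarrow> complex \<Rightarrow> (nat \<Rightarrow> complex) \<Rightarrow> real \<Rightarrow> complex" where
  "line_through f j c z t = f (z(j := z j + of_real t * c))"

definition partial_deriv ::
  "nat \<Rightarrow> complex \<Rightarrow> ((nat \<Rightarrow> complex) \<Rightarrow> complex) \<Rightarrow> (nat \<Rightarrow> complex) \<Rightarrow> complex" where
  "partial_deriv j c f z = vector_derivative (line_through f j c z) (at 0)"

definition C1_on :: "nat \<Rightarrow> (nat \<Rightarrow> complex) set \<Rightarrow> ((nat \<Rightarrow> complex) \<Rightarrow> complex) \<Rightarrow> bool" where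
  "C1_on n \<Omega> f \<longleftrightarrow>
     (\<forall>j<n. \<forall>c\<in>{1, \<i>}.
        (\<forall>z\<in>\<Omega>. line_through f j c z differentiable at 0) \<and>
        continuous_on \<Omega> (partial_deriv j c f))"

definition C2_on :: "nat \<Rightarrow> (nat \<Rightarrow> complex) set \<Rightarrow> ((nat \<Rightarrow> complex) \<Rightarrow> complex) \<Rightarrow> bool" where
  "C2_on n \<Omega> f \<longleftrightarrow>
     C1_on n \<Omega> f \<and> (\<forall>j<n. \<forall>c\<in>{1, \<i>}. C1_on n \<Omega> (partial_deriv j c f))"

text \<open>
  Complex-valued harmonic functions on an open set in the plane: \<open>u'\<close> and \<open>u''\<close> are the first and
  second real Frechet derivatives, and the last conjunct is \<open>u\<^sub>x\<^sub>x + u\<^sub>y\<^sub>y = 0\<close>.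
\<close>

definition harmonic_on :: "complex set \<Rightarrow> (complex \<Rightarrow> complex) \<Rightarrow> bool" where
  "harmonic_on D u \<longleftrightarrow>
     (\<exists>(u' :: complex \<Rightarrow> complex \<Rightarrow>\<^sub>L complex) (u'' :: complex \<Rightarrow> complex \<Rightarrow>\<^sub>L complex \<Rightarrow>\<^sub>L complex).
        continuous_on D u'' \<and>
        (\<forall>\<zeta>\<in>D. (u has_derivative blinfun_apply (u' \<zeta>)) (at \<zeta>) \<and>
                (u' has_derivative blinfun_apply (u'' \<zeta>)) (at \<zeta>) \<and>
                blinfun_apply (blinfun_apply (u'' \<zeta>) 1) 1
                  + blinfun_apply (blinfun_apply (u'' \<zeta>) \<i>) \<i> = 0))"

text \<open>
  The boundary is taken inside \<open>\<complex>\<^sup>n\<close>, not inside the whole type. The distance is extended-real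
  valued, so that it is infinite when the boundary is empty.
\<close>

definition boundary_dist :: "nat \<Rightarrow> (nat \<Rightarrow> complex) set \<Rightarrow> (nat \<Rightarrow> complex) \<Rightarrow> ereal" where
  "boundary_dist n \<Omega> z =
     (INF w \<in> (top_of_set (cspace n)) frontier_of \<Omega>. ereal (lp_norm n 2 (\<lambda>j. z j - w j)))"

definition pluriharmonic_on ::
  "nat \<Rightarrow> (nat \<Rightarrow> complex) set \<Rightarrow> ((nat \<Rightarrow> complex) \<Rightarrow> complex) \<Rightarrow> bool" where
  "pluriharmonic_on n \<Omega> f \<longleftrightarrow>
     C2_on n \<Omega> f \<and>
     (\<forall>z\<in>\<Omega>. \<forall>\<theta>\<in>cspace n. lp_norm n 2 \<theta> = 1 \<longrightarrow>
        harmonic_on {\<zeta>. ereal (cmod \<zeta>) < boundary_dist n \<Omega> z} (\<lambda>\<zeta>. f (\<lambda>j. z j + \<zeta> * \<theta> j)))"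

definition has_expansion_on ::
  "nat \<Rightarrow> (nat \<Rightarrow> complex) set \<Rightarrow> ((nat \<Rightarrow> complex) \<Rightarrow> complex)
     \<Rightarrow> ((nat \<Rightarrow> nat) \<Rightarrow> complex) \<Rightarrow> ((nat \<Rightarrow> nat) \<Rightarrow> complex) \<Rightarrow> bool" where
  "has_expansion_on n \<Omega> f a b \<longleftrightarrow>
     (\<forall>z\<in>\<Omega>.
        (\<lambda>\<alpha>. a \<alpha> * mi_power n z \<alpha>) summable_on multi_indices n \<and>
        (\<lambda>\<alpha>. cnj (b \<alpha>) * mi_power n (\<lambda>j. cnj (z j)) \<alpha>) summable_on multi_indices n \<and>
        f z = (\<Sum>\<^sub>\<infinity>\<alpha>\<in>multi_indices n. a \<alpha> * mi_power n z \<alpha>)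
            + (\<Sum>\<^sub>\<infinity>\<alpha>\<in>multi_indices n. cnj (b \<alpha>) * mi_power n (\<lambda>j. cnj (z j)) \<alpha>))"

definition bohr_term ::
  "nat \<Rightarrow> ((nat \<Rightarrow> nat) \<Rightarrow> complex) \<Rightarrow> ((nat \<Rightarrow> nat) \<Rightarrow> complex) \<Rightarrow> (nat \<Rightarrow> complex) \<Rightarrow> nat \<Rightarrow> real" where
  "bohr_term n a b z k =
     (\<Sum>\<alpha> | \<alpha> \<in> multi_indices n \<and> mi_degree n \<alpha> = k. (cmod (a \<alpha>) + cmod (b \<alpha>)) * cmod (mi_power n z \<alpha>))"

text \<open>
  The series over \<open>k \<ge> 1\<close> is indexed by \<open>Suc k\<close>; its convergence is required explicitly because
  \<^const>\<open>suminf\<close> is unspecified on divergent series.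
\<close>

definition bohr_property :: "nat \<Rightarrow> ereal \<Rightarrow> real \<Rightarrow> bool" where
  "bohr_property n p \<rho> \<longleftrightarrow>
     (\<forall>f a b. pluriharmonic_on n (lp_ball n p 1) f \<longrightarrow>
        has_expansion_on n (lp_ball n p 1) f a b \<longrightarrow>
        b (\<lambda>_. 0) = 0 \<longrightarrow>
        (\<forall>z\<in>lp_ball n p 1. cmod (f z) \<le> 1) \<longrightarrow>
        (\<forall>z\<in>lp_ball n p \<rho>.
           summable (\<lambda>k. bohr_term n a b z (Suc k)) \<and> (\<Sum>k. bohr_term n a b z (Suc k)) \<le> 1))"

definition bohr_radius :: "nat \<Rightarrow> ereal \<Rightarrow> real" where
  "bohr_radius n p = (GREATEST \<rho>. bohr_property n p \<rho>)"

end

theory Submission imports Defs begin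

text \<open>
  Write \<open>q = min {p, 2}\<close>. For both inequalities the size of a coefficient is compared with the size
  of the function, one degree \<open>k\<close> at a time; the factor that is lost in degree \<open>k\<close> is a \<open>k\<close>-th power,
  and its base determines the radius.

  Lower bound. Averaging \<open>\<bar>f\<bar>\<^sup>2\<close> over the torus \<open>{(z\<^sub>1\<omega>\<^sub>1, \<dots>, z\<^sub>n\<omega>\<^sub>n). \<bar>\<omega>\<^sub>j\<bar> = 1}\<close> makes all monomials and
  conjugate monomials of positive degree orthogonal, so if \<open>\<bar>f\<bar> \<le> 1\<close>, then the sum over
  \<open>\<alpha> \<noteq> 0\<close> satisfies \<open>\<Sum> (\<bar>a\<^sub>\<alpha>\<bar>\<^sup>2 + \<bar>b\<^sub>\<alpha>\<bar>\<^sup>2) \<bar>z\<^sup>\<alpha>\<bar>\<^sup>2 \<le> 1\<close> (\<open>expansion_l2_bound\<close>). There are at most \<open>(e n)\<^sup>k\<close> multi-indices of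
  degree \<open>k\<close>, so for \<open>p \<ge> 2\<close> the Cauchy-Schwarz inequality bounds the degree \<open>k\<close> part of the Bohr sum on
  the unit ball by \<open>(C n\<^bsup>1/2\<^esup>)\<^sup>k\<close>. For \<open>p \<le> 2\<close> the same inequality, used for one \<open>\<alpha>\<close> at the point
  whose \<open>j\<close>-th coordinate is proportional to \<open>\<alpha>\<^sub>j\<^bsup>1/p\<^esup>\<close>, is Cauchy's estimate
  \<open>\<bar>a\<^sub>\<alpha>\<bar> \<le> 2\<^sup>k (\<Prod>\<^sub>j k\<^bsup>\<alpha>\<^sub>j\<^esup> / \<alpha>\<^sub>j\<^bsup>\<alpha>\<^sub>j\<^esup>)\<^bsup>1/p\<^esup>\<close> (\<open>coefficient_bound\<close>). The sum over \<open>\<alpha>\<close> of the \<open>p\<close>-th powers of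
  the resulting terms is at most \<open>C\<^sup>k\<close>, because \<open>\<alpha>\<^sub>j\<^bsup>\<alpha>\<^sub>j\<^esup> \<ge> \<alpha>\<^sub>j!\<close> turns it into a part of a product of
  exponential series (\<open>sum_degree_le_exp\<close>); Hoelder's inequality then gives \<open>(C n\<^bsup>1-1/p\<^esup>)\<^sup>k\<close>. In both cases a
  radius of a small constant times \<open>n\<^bsup>-(1-1/q)\<^esup>\<close> leaves a geometric series with sum at most 1.

  Upper bound. Holomorphic polynomials are enough. The coordinates are split into \<open>d \<approx> ln n\<close> blocks
  of length \<open>m \<approx> n / d\<close>, and the polynomial is \<open>P(z) = \<Sum>\<^sub>i \<epsilon>\<^sub>i z\<^bsup>(0)\<^esup>\<^bsub>i\<^sub>0\<^esub> \<cdots> z\<^bsup>(d-1)\<^esup>\<^bsub>i\<^bsub>d-1\<^esub>\<^esub>\<close>, the sum over all ways of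
  choosing one coordinate from each block. For suitable signs, \<open>\<bar>P\<bar> \<le> 18 (d m)\<^sup>2\<close> as long as each block has
  Euclidean norm at most 1 (\<open>exists_small_sign_tensor\<close>): exponential moments and a finite net show that
  random signs work. The Euclidean norm of a block is at most its \<open>\<ell>\<^sub>q\<close> norm, so homogeneity in each
  block and the AM-GM inequality bound \<open>P\<close> on the \<open>\<ell>\<^sub>p\<close> ball by \<open>18 (d m)\<^sup>2 (n\<^bsup>1/q-1/p\<^esup> d\<^bsup>-1/q\<^esup>)\<^sup>d\<close>. All \<open>m\<^sup>d\<close>
  coefficients have modulus 1, so the Bohr sum of \<open>P\<close> at \<open>t n\<^bsup>-1/p\<^esup> (1, \<dots>, 1)\<close> is \<open>(m t n\<^bsup>-1/p\<^esup>)\<^sup>d\<close>. Comparing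
  the two and taking \<open>d\<close>-th roots gives \<open>t \<le> C m\<^bsup>-(1-1/q)\<^esup>\<close>, and \<open>1 / m \<approx> ln n / n\<close>. A power of \<open>n\<close> has a
  bounded \<open>d\<close>-th root when \<open>d \<ge> ln n\<close>; for this reason the bound on \<open>P\<close> may be wasteful by any
  factor that is polynomial in \<open>d m\<close>, and a very coarse probabilistic argument suffices.

  The largest radius exists because a ball is the union of the smaller balls with the same centre, so that the
  supremum of the admissible radii is admissible (\<open>bohr_radius_between\<close>).
\<close>

section \<open>Polynomials are pluriharmonic\<close>

lemma mi_power_update:
  assumes "j < n"
  shows "mi_power n (z(j := w)) \<alpha> = w ^ \<alpha> j * (\<Prod>i\<in>{..<n} - {j}. z i ^ \<alpha> i)"
proof -
  have "mi_power n (z(j := w)) \<alpha> = w ^ \<alpha> j * (\<Prod>i\<in>{..<n} - {j}. (z(j := w)) i ^ \<alpha> i)"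
    unfolding mi_power_def using assms by (subst prod.remove[where x = j]) auto
  also have "(\<Prod>i\<in>{..<n} - {j}. (z(j := w)) i ^ \<alpha> i) = (\<Prod>i\<in>{..<n} - {j}. z i ^ \<alpha> i)"
    by (rule prod.cong) auto
  finally show ?thesis .
qed

lemma mi_power_update_exponent:
  assumes "j < n"
  shows "mi_power n z (\<alpha>(j := k)) = z j ^ k * (\<Prod>i\<in>{..<n} - {j}. z i ^ \<alpha> i)"
proof -
  have "mi_power n z (\<alpha>(j := k)) = z j ^ k * (\<Prod>i\<in>{..<n} - {j}. z i ^ (\<alpha>(j := k)) i)"
    unfolding mi_power_def using assms by (subst prod.remove[where x = j]) auto
  also have "(\<Prod>i\<in>{..<n} - {j}. z i ^ (\<alpha>(j := k)) i) = (\<Prod>i\<in>{..<n} - {j}. z i ^ \<alpha> i)"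
    by (rule prod.cong) auto
  finally show ?thesis .
qed

text \<open>
  Polynomials are given as arbitrary finite sums of terms \<open>a\<^sub>x z\<^bsup>\<mu>\<^sub>x\<^esup>\<close>, with possibly repeated exponents
  \<open>\<mu>\<^sub>x\<close>, so that the derivative is again a sum over the same index set \<open>S\<close>.
\<close>

lemma polynomial_line_derivative:
  assumes "j < n"
  shows "(line_through (\<lambda>z. \<Sum>x\<in>S. a x * mi_power n z (\<mu> x)) j c z has_vector_derivative
           (\<Sum>x\<in>S. (c * a x * of_nat (\<mu> x j)) * mi_power n z ((\<mu> x)(j := \<mu> x j - 1)))) (at 0)"
proof -
  have lt: "line_through (\<lambda>z. \<Sum>x\<in>S. a x * mi_power n z (\<mu> x)) j c z =
     (\<lambda>t. \<Sum>x\<in>S. a x * ((z j + of_real t * c) ^ \<mu> x j * (\<Prod>i\<in>{..<n} - {j}. z i ^ \<mu> x i)))"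
    unfolding line_through_def by (rule ext) (simp add: mi_power_update[OF assms])
  have "((\<lambda>t. a x * ((z j + of_real t * c) ^ \<mu> x j * (\<Prod>i\<in>{..<n} - {j}. z i ^ \<mu> x i)))
      has_vector_derivative (c * a x * of_nat (\<mu> x j)) * mi_power n z ((\<mu> x)(j := \<mu> x j - 1))) (at 0)"
    for x
  proof -
    have "((\<lambda>w. a x * (w ^ \<mu> x j * (\<Prod>i\<in>{..<n} - {j}. z i ^ \<mu> x i))) has_field_derivative
        a x * (of_nat (\<mu> x j) * z j ^ (\<mu> x j - 1) * (\<Prod>i\<in>{..<n} - {j}. z i ^ \<mu> x i)))
        (at (z j + of_real 0 * c))"
      by (auto intro!: derivative_eq_intros)
    moreover have "((\<lambda>t. z j + of_real t * c) has_vector_derivative c) (at 0)"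
      by (auto intro!: derivative_eq_intros simp: has_vector_derivative_def scaleR_conv_of_real)
    ultimately have "(((\<lambda>w. a x * (w ^ \<mu> x j * (\<Prod>i\<in>{..<n} - {j}. z i ^ \<mu> x i))) \<circ>
        (\<lambda>t. z j + of_real t * c)) has_vector_derivative
        c * (a x * (of_nat (\<mu> x j) * z j ^ (\<mu> x j - 1) * (\<Prod>i\<in>{..<n} - {j}. z i ^ \<mu> x i)))) (at 0)"
      by (intro field_vector_diff_chain_at)
    then show ?thesis
      by (simp add: o_def mi_power_update_exponent[OF assms] mult_ac)
  qed
  then show ?thesis unfolding lt by (intro has_vector_derivative_sum)
qed

lemma polynomial_partial_deriv:
  assumes "j < n"
  shows "partial_deriv j c (\<lambda>z. \<Sum>x\<in>S. a x * mi_power n z (\<mu> x)) =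
     (\<lambda>z. \<Sum>x\<in>S. (c * a x * of_nat (\<mu> x j)) * mi_power n z ((\<mu> x)(j := \<mu> x j - 1)))"
  unfolding partial_deriv_def
  by (rule ext, rule vector_derivative_at, rule polynomial_line_derivative[OF assms])

lemma continuous_on_polynomial:
  "continuous_on \<Omega> (\<lambda>z. \<Sum>x\<in>S. a x * mi_power n z (\<mu> x))"
  unfolding mi_power_def
  by (intro continuous_intros continuous_on_subset[OF continuous_on_product_coordinates]) auto

lemma C1_on_polynomial: "C1_on n \<Omega> (\<lambda>z. \<Sum>x\<in>S. a x * mi_power n z (\<mu> x))"
  unfolding C1_on_def
  using polynomial_line_derivative
  by (auto simp: polynomial_partial_deriv intro!: continuous_on_polynomial differentiableI_vector)

lemma C2_on_polynomial: "C2_on n \<Omega> (\<lambda>z. \<Sum>x\<in>S. a x * mi_power n z (\<mu> x))"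
  unfolding C2_on_def by (simp add: polynomial_partial_deriv C1_on_polynomial del: One_nat_def)

text \<open>
  The second derivative of a holomorphic \<open>u\<close> is \<open>(h, k) \<mapsto> u'' h k\<close>, whose trace is
  \<open>u'' (1 + \<i>\<^sup>2) = 0\<close>.
\<close>

lemma harmonic_on_poly: "harmonic_on D (poly q)"
proof -
  let ?u1 = "\<lambda>\<zeta>. blinfun_mult_right (poly (pderiv q) \<zeta>)"
  let ?u2 = "\<lambda>\<zeta>. blinfun_compose (Blinfun blinfun_mult_right) (blinfun_mult_right (poly (pderiv (pderiv q)) \<zeta>))"
  have B: "blinfun_apply (Blinfun blinfun_mult_right) = (blinfun_mult_right :: complex \<Rightarrow> complex \<Rightarrow>\<^sub>L complex)"
    by (rule bounded_linear_Blinfun_apply[OF bounded_linear_blinfun_mult_right])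
  have "continuous_on D ?u2"
    by (intro continuous_intros bounded_linear.continuous_on[OF bounded_linear_blinfun_mult_right])
  moreover have "(poly q has_derivative blinfun_apply (?u1 \<zeta>)) (at \<zeta>)" for \<zeta>
    using poly_DERIV[of q \<zeta>] by (simp add: has_field_derivative_def)
  moreover have "(?u1 has_derivative blinfun_apply (?u2 \<zeta>)) (at \<zeta>)" for \<zeta>
  proof -
    have "(poly (pderiv q) has_derivative (*) (poly (pderiv (pderiv q)) \<zeta>)) (at \<zeta>)"
      using poly_DERIV[of "pderiv q" \<zeta>] by (simp add: has_field_derivative_def)
    then have "(?u1 has_derivative (\<lambda>h. blinfun_mult_right (poly (pderiv (pderiv q)) \<zeta> * h))) (at \<zeta>)"
      by (rule bounded_linear.has_derivative[OF bounded_linear_blinfun_mult_right])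
    moreover have "blinfun_apply (?u2 \<zeta>) = (\<lambda>h. blinfun_mult_right (poly (pderiv (pderiv q)) \<zeta> * h))"
      by (rule ext) (simp add: B)
    ultimately show ?thesis by simp
  qed
  moreover have "blinfun_apply (blinfun_apply (?u2 \<zeta>) 1) 1 + blinfun_apply (blinfun_apply (?u2 \<zeta>) \<i>) \<i> = 0" for \<zeta>
    by (simp add: B mult.assoc)
  ultimately show ?thesis
    unfolding harmonic_on_def by (intro exI[of _ ?u1] exI[of _ ?u2]) simp
qed

lemma pluriharmonic_on_polynomial:
  "pluriharmonic_on n \<Omega> (\<lambda>z. \<Sum>x\<in>S. a x * mi_power n z (\<mu> x))"
proof -
  have "(\<lambda>\<zeta>. \<Sum>x\<in>S. a x * mi_power n (\<lambda>j. z j + \<zeta> * \<theta> j) (\<mu> x)) =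
        poly (\<Sum>x\<in>S. smult (a x) (\<Prod>j<n. [:z j, \<theta> j:] ^ \<mu> x j))" for z \<theta>
    by (rule ext) (simp add: poly_sum poly_prod mi_power_def)
  then show ?thesis
    unfolding pluriharmonic_on_def by (simp add: C2_on_polynomial harmonic_on_poly)
qed

section \<open>Norms on complex sequences of finite length\<close>

lemma exponent_cases:
  fixes p :: ereal
  assumes "1 \<le> p"
  obtains "p = \<infinity>" | r where "p = ereal r" "1 \<le> r"
  using assms by (cases p) auto

lemma lp_norm_cong:
  assumes "\<And>j. j < n \<Longrightarrow> cmod (z j) = cmod (w j)"
  shows "lp_norm n p z = lp_norm n p w"
proof -
  have "(\<lambda>j. cmod (z j)) ` {..<n} = (\<lambda>j. cmod (w j)) ` {..<n}"
    using assms by (intro image_cong) auto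
  then show ?thesis unfolding lp_norm_def using assms by simp
qed

lemma lp_norm_scale:
  assumes "1 \<le> p" "1 \<le> n" "0 \<le> c"
  shows "lp_norm n p (\<lambda>j. of_real c * z j) = c * lp_norm n p z"
  using \<open>1 \<le> p\<close>
proof (cases rule: exponent_cases)
  case 1
  have "mono ((*) c)" using \<open>0 \<le> c\<close> by (intro monoI mult_left_mono)
  then have "c * Max ((\<lambda>j. cmod (z j)) ` {..<n}) = Max ((*) c ` (\<lambda>j. cmod (z j)) ` {..<n})"
    using \<open>1 \<le> n\<close> by (intro mono_Max_commute) (auto simp: lessThan_empty_iff)
  then show ?thesis using 1 \<open>0 \<le> c\<close> by (simp add: lp_norm_def norm_mult image_image)
next
  case (2 r)
  have "(\<Sum>j<n. cmod (of_real c * z j) powr r) = c powr r * (\<Sum>j<n. cmod (z j) powr r)"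
    using \<open>0 \<le> c\<close> by (simp add: norm_mult powr_mult sum_distrib_left)
  then show ?thesis using 2 \<open>0 \<le> c\<close> by (simp add: lp_norm_def powr_mult powr_powr sum_nonneg)
qed

lemma lp_ball_scale:
  assumes "1 \<le> p" "1 \<le> n" "0 < \<rho>" "z \<in> lp_ball n p \<rho>"
  shows "(\<lambda>j. of_real (1 / \<rho>) * z j) \<in> lp_ball n p 1"
proof -
  have "lp_norm n p (\<lambda>j. of_real (1 / \<rho>) * z j) = 1 / \<rho> * lp_norm n p z"
    using assms by (intro lp_norm_scale) auto
  moreover have "1 / \<rho> * lp_norm n p z < 1"
    using assms by (simp add: lp_ball_def field_simps)
  ultimately show ?thesis using assms by (simp add: lp_ball_def cspace_def)
qed

lemma lp_ball_finite_exponent: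
  assumes "1 \<le> r"
  shows "z \<in> lp_ball n (ereal r) 1 \<longleftrightarrow> z \<in> cspace n \<and> (\<Sum>j<n. cmod (z j) powr r) < 1"
proof -
  define s where "s = (\<Sum>j<n. cmod (z j) powr r)"
  have "0 \<le> s" unfolding s_def by (intro sum_nonneg) auto
  have "s powr (1 / r) < 1 \<longleftrightarrow> s < 1"
  proof
    assume "s < 1"
    then have "s powr (1 / r) < 1 powr (1 / r)"
      using \<open>0 \<le> s\<close> assms by (intro powr_less_mono2) auto
    then show "s powr (1 / r) < 1" by simp
  next
    assume "s powr (1 / r) < 1"
    show "s < 1"
    proof (rule ccontr)
      assume "\<not> s < 1"
      then have "1 \<le> s powr (1 / r)" using assms by (intro ge_one_powr_ge_zero) auto
      then show False using \<open>s powr (1 / r) < 1\<close> by simp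
    qed
  qed
  then show ?thesis by (simp add: lp_ball_def lp_norm_def s_def)
qed

lemma Young_powr:
  fixes x y t :: real
  assumes "0 \<le> x" "0 < y" "0 \<le> t" "t \<le> 1"
  shows "x powr t * y powr (1 - t) \<le> t * x + (1 - t) * y"
  using assms Youngs_inequality_0[of t "1 - t" x y] by (cases "x = 0") auto

text \<open>
  This is \<open>\<parallel>z\<parallel>\<^sub>q \<le> n\<^bsup>1/q-1/p\<^esup> \<parallel>z\<parallel>\<^sub>p\<close> raised to the power \<open>q\<close>. For \<open>p = \<infinity>\<close> the exponent is
  \<open>1 = 1 - q/\<infinity>\<close>, in agreement with \<open>real_of_ereal \<infinity> = 0\<close> and division by zero giving zero.
\<close>

lemma lp_ball_lq_sum:
  assumes "1 \<le> p" "1 \<le> n" "z \<in> lp_ball n p 1"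
  shows "(\<Sum>j<n. cmod (z j) powr real_of_ereal (min p 2))
           \<le> real n powr (1 - real_of_ereal (min p 2) / real_of_ereal p)"
  using \<open>1 \<le> p\<close>
proof (cases rule: exponent_cases)
  case 1
  have "cmod (z j) powr 2 \<le> 1" if "j < n" for j
  proof -
    have "cmod (z j) \<le> Max ((\<lambda>j. cmod (z j)) ` {..<n})" using that by (intro Max_ge) auto
    then have "cmod (z j) \<le> 1" using assms 1 by (auto simp: lp_ball_def lp_norm_def)
    then show ?thesis by (intro powr_le1) auto
  qed
  then have "(\<Sum>j<n. cmod (z j) powr 2) \<le> (\<Sum>j<n. 1)" by (intro sum_mono) auto
  moreover have "real_of_ereal (min p 2) = 2" using 1 by (simp add: min_def)
  ultimately show ?thesis using 1 \<open>1 \<le> n\<close> by simp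
next
  case (2 r)
  then have le: "(\<Sum>j<n. cmod (z j) powr r) < 1"
    using assms by (simp add: lp_ball_finite_exponent)
  show ?thesis
  proof (cases "r \<le> 2")
    case True
    then have "min p 2 = p" using 2 by (simp add: min_def)
    then show ?thesis using 2 le \<open>1 \<le> n\<close> by simp
  next
    case False
    have q: "real_of_ereal (min p 2) = 2" using 2 False by (auto simp: min_def)
    \<comment> \<open>Young's inequality for each pair of \<open>\<bar>z\<^sub>j\<bar>\<^sup>r\<close> and the weight \<open>1/n\<close> replaces Hoelder's inequality.\<close>
    have "cmod (z j) powr 2 * (1 / real n) powr (1 - 2 / r)
        \<le> 2 / r * (cmod (z j) powr r) + (1 - 2 / r) * (1 / real n)" for j
      using Young_powr[of "cmod (z j) powr r" "1 / real n" "2 / r"] False \<open>1 \<le> n\<close>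
      by (simp add: powr_powr)
    then have "(\<Sum>j<n. cmod (z j) powr 2 * (1 / real n) powr (1 - 2 / r))
        \<le> (\<Sum>j<n. 2 / r * (cmod (z j) powr r) + (1 - 2 / r) * (1 / real n))"
      by (intro sum_mono)
    also have "\<dots> = 2 / r * (\<Sum>j<n. cmod (z j) powr r) + (1 - 2 / r)"
      using \<open>1 \<le> n\<close> by (simp add: sum.distrib sum_distrib_left)
    also have "\<dots> \<le> 2 / r * 1 + (1 - 2 / r)"
      using le False by (intro add_right_mono mult_left_mono) auto
    finally have "(\<Sum>j<n. cmod (z j) powr 2) * (1 / real n) powr (1 - 2 / r) \<le> 1"
      by (simp add: sum_distrib_right)
    then have "(\<Sum>j<n. cmod (z j) powr 2) \<le> real n powr (1 - 2 / r)"
      using \<open>1 \<le> n\<close> by (simp add: powr_divide field_simps)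
    then show ?thesis using q 2 by simp
  qed
qed

lemma lp_norm_constant_vector:
  assumes "1 \<le> p" "1 \<le> n" "0 \<le> c"
  shows "lp_norm n p (\<lambda>j. if j < n then of_real (c * real n powr - (1 / real_of_ereal p)) else 0) = c"
  using \<open>1 \<le> p\<close>
proof (cases rule: exponent_cases)
  case 1
  have "(\<lambda>j. cmod (if j < n then of_real (c * real n powr - (1 / real_of_ereal p)) else 0)) ` {..<n} = {c}"
    using assms 1 by (auto simp: image_iff intro!: exI[of _ 0])
  then show ?thesis using 1 by (simp add: lp_norm_def)
next
  case (2 r)
  have "(\<Sum>j<n. cmod (if j < n then of_real (c * real n powr - (1 / r)) else 0) powr r)
      = (\<Sum>j<n. (c * real n powr - (1 / r)) powr r)"
    using \<open>0 \<le> c\<close> by (intro sum.cong) (auto simp: norm_mult)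
  also have "\<dots> = c powr r"
  proof -
    have "(c * real n powr - (1 / r)) powr r = c powr r * real n powr (- (1 / r) * r)"
      using \<open>0 \<le> c\<close> by (subst powr_mult) (auto simp only: powr_powr powr_ge_zero)
    also have "- (1 / r) * r = -1" using 2 by simp
    finally show ?thesis using \<open>1 \<le> n\<close> by (simp add: powr_minus_divide)
  qed
  finally show ?thesis using 2 \<open>0 \<le> c\<close> by (simp add: lp_norm_def powr_powr)
qed

section \<open>Square sums of the coefficients of a bounded expansion\<close>

lemma roots_of_unity_orthogonal:
  assumes "a < N" "b < N"
  shows "(\<Sum>t<N. cis (2 * pi * real t / real N) ^ a * cnj (cis (2 * pi * real t / real N) ^ b))
           = (if a = b then of_nat N else 0)"
proof -
  define w where "w = cis (2 * pi * real a / real N) * cnj (cis (2 * pi * real b / real N))"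
  have "N > 0" using assms by simp
  have eq: "cis (2 * pi * real t / real N) ^ a * cnj (cis (2 * pi * real t / real N) ^ b) = w ^ t" for t
    unfolding w_def cis_cnj power_mult_distrib Complex.DeMoivre
    by (rule arg_cong2[where f = "(*)"]; rule arg_cong[where f = cis]; simp)
  show ?thesis
  proof (cases "a = b")
    case True
    then have "w = 1" by (simp add: w_def cis_cnj cis_mult)
    then show ?thesis using True eq by simp
  next
    case False
    have "cis (- (2 * pi * real b)) = 1" using cis_multiple_2pi[of "- real b"] by simp
    then have "w ^ N = 1"
      unfolding w_def using \<open>N > 0\<close> cis_multiple_2pi[of "real a"]
      by (simp add: Complex.DeMoivre cis_cnj power_mult_distrib)
    have "w \<noteq> 1"
    proof
      assume "w = 1"
      then have "cis (2 * pi * real a / real N) * (cnj (cis (2 * pi * real b / real N)) * cis (2 * pi * real b / real N))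
                 = cis (2 * pi * real b / real N)"
        unfolding w_def by (simp add: mult.assoc[symmetric])
      then have "cis (2 * pi * real a / real N) = cis (2 * pi * real b / real N)"
        by (simp add: cis_cnj cis_mult)
      then show False
        using inj_onD[OF bij_betw_imp_inj_on[OF Complex.bij_betw_roots_unity[OF \<open>N > 0\<close>]], of a b] assms False
        by simp
    qed
    then have "(\<Sum>t<N. w ^ t) = 0" using \<open>w ^ N = 1\<close> by (simp add: geometric_sum)
    then show ?thesis using eq False by simp
  qed
qed

text \<open>
  Monomials whose exponents are less than \<open>N\<close> are orthogonal already over the \<open>N\<close>-th roots of unity, so
  that a finite average takes the place of an integral over the torus.
\<close>

lemma torus_grid_Parseval:
  fixes c :: "'x \<Rightarrow> complex" and \<gamma> :: "'x \<Rightarrow> nat \<Rightarrow> nat"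
  assumes "finite S" and lt: "\<And>x j. x \<in> S \<Longrightarrow> j < n \<Longrightarrow> \<gamma> x j < N"
    and dist: "\<And>x y. x \<in> S \<Longrightarrow> y \<in> S \<Longrightarrow> x \<noteq> y \<Longrightarrow> \<exists>j<n. \<gamma> x j \<noteq> \<gamma> y j"
  shows "(\<Sum>t\<in>PiE {..<n} (\<lambda>_. {..<N}).
            (cmod (\<Sum>x\<in>S. c x * (\<Prod>j<n. cis (2 * pi * real (t j) / real N) ^ \<gamma> x j)))\<^sup>2)
         = real N ^ n * (\<Sum>x\<in>S. (cmod (c x))\<^sup>2)"
proof -
  let ?e = "\<lambda>t. cis (2 * pi * real t / real N)"
  let ?T = "PiE {..<n} (\<lambda>_. {..<N})"
  have orth: "(\<Sum>t\<in>?T. (\<Prod>j<n. ?e (t j) ^ \<gamma> x j) * cnj (\<Prod>j<n. ?e (t j) ^ \<gamma> y j))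
      = (if x = y then of_nat N ^ n else 0)" if "x \<in> S" "y \<in> S" for x y
  proof -
    have "(\<Sum>t\<in>?T. (\<Prod>j<n. ?e (t j) ^ \<gamma> x j) * cnj (\<Prod>j<n. ?e (t j) ^ \<gamma> y j))
        = (\<Sum>t\<in>?T. \<Prod>j<n. ?e (t j) ^ \<gamma> x j * cnj (?e (t j) ^ \<gamma> y j))"
      by (simp add: prod.distrib)
    also have "\<dots> = (\<Prod>j<n. \<Sum>t<N. ?e t ^ \<gamma> x j * cnj (?e t ^ \<gamma> y j))"
      by (rule prod_sum_PiE[symmetric]) auto
    also have "\<dots> = (\<Prod>j<n. if \<gamma> x j = \<gamma> y j then of_nat N else 0)"
      using lt that by (intro prod.cong refl roots_of_unity_orthogonal) auto
    also have "\<dots> = (if x = y then of_nat N ^ n else 0)"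
      using dist[OF that] by (auto simp: prod_zero_iff)
    finally show ?thesis .
  qed
  have "complex_of_real (\<Sum>t\<in>?T. (cmod (\<Sum>x\<in>S. c x * (\<Prod>j<n. ?e (t j) ^ \<gamma> x j)))\<^sup>2)
      = (\<Sum>t\<in>?T. (\<Sum>x\<in>S. c x * (\<Prod>j<n. ?e (t j) ^ \<gamma> x j)) * cnj (\<Sum>y\<in>S. c y * (\<Prod>j<n. ?e (t j) ^ \<gamma> y j)))"
    by (simp only: of_real_sum complex_norm_square)
  also have "\<dots> = (\<Sum>t\<in>?T. \<Sum>x\<in>S. \<Sum>y\<in>S. (c x * cnj (c y)) *
      ((\<Prod>j<n. ?e (t j) ^ \<gamma> x j) * cnj (\<Prod>j<n. ?e (t j) ^ \<gamma> y j)))"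
    unfolding cnj_sum sum_product complex_cnj_mult by (simp only: mult_ac)
  also have "\<dots> = (\<Sum>x\<in>S. \<Sum>y\<in>S. (c x * cnj (c y)) *
      (\<Sum>t\<in>?T. (\<Prod>j<n. ?e (t j) ^ \<gamma> x j) * cnj (\<Prod>j<n. ?e (t j) ^ \<gamma> y j)))"
    unfolding sum_distrib_left by (subst sum.swap, rule sum.cong[OF refl], rule sum.swap)
  also have "\<dots> = (\<Sum>x\<in>S. \<Sum>y\<in>S. if x = y then (c x * cnj (c y)) * of_nat N ^ n else 0)"
    by (intro sum.cong refl) (subst orth, auto)
  also have "\<dots> = (\<Sum>x\<in>S. c x * cnj (c x) * of_nat N ^ n)"
    using \<open>finite S\<close> by (simp add: sum.delta)
  also have "\<dots> = complex_of_real (real N ^ n * (\<Sum>x\<in>S. (cmod (c x))\<^sup>2))"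
    by (simp add: complex_norm_square[symmetric] sum_distrib_left mult_ac)
  finally show ?thesis by (simp only: of_real_eq_iff)
qed

lemma torus_bound_imp_l2_bound:
  fixes c :: "'x \<Rightarrow> complex" and \<gamma> :: "'x \<Rightarrow> nat \<Rightarrow> nat"
  assumes "finite S"
    and dist: "\<And>x y. x \<in> S \<Longrightarrow> y \<in> S \<Longrightarrow> x \<noteq> y \<Longrightarrow> \<exists>j<n. \<gamma> x j \<noteq> \<gamma> y j"
    and bound: "\<And>\<omega>. (\<And>j. cmod (\<omega> j) = 1) \<Longrightarrow> cmod (\<Sum>x\<in>S. c x * (\<Prod>j<n. \<omega> j ^ \<gamma> x j)) \<le> K"
  shows "(\<Sum>x\<in>S. (cmod (c x))\<^sup>2) \<le> K\<^sup>2"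
proof -
  define N where "N = Suc (\<Sum>x\<in>S. \<Sum>j<n. \<gamma> x j)"
  have lt: "\<gamma> x j < N" if "x \<in> S" "j < n" for x j
  proof -
    have "\<gamma> x j \<le> (\<Sum>j<n. \<gamma> x j)" using that by (intro member_le_sum) auto
    also have "\<dots> \<le> (\<Sum>x\<in>S. \<Sum>j<n. \<gamma> x j)"
      using that \<open>finite S\<close> by (intro member_le_sum[where f = "\<lambda>x. \<Sum>j<n. \<gamma> x j"]) auto
    finally show ?thesis by (simp add: N_def)
  qed
  let ?T = "PiE {..<n} (\<lambda>_. {..<N})"
  have "real N ^ n * (\<Sum>x\<in>S. (cmod (c x))\<^sup>2) =
      (\<Sum>t\<in>?T. (cmod (\<Sum>x\<in>S. c x * (\<Prod>j<n. cis (2 * pi * real (t j) / real N) ^ \<gamma> x j)))\<^sup>2)"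
    by (rule torus_grid_Parseval[symmetric]) (use \<open>finite S\<close> lt dist in auto)
  also have "\<dots> \<le> (\<Sum>t\<in>?T. K\<^sup>2)"
    by (intro sum_mono power_mono bound) auto
  also have "\<dots> = real N ^ n * K\<^sup>2" by (simp add: card_PiE)
  finally show ?thesis using mult_le_cancel_left_pos[of "real N ^ n"] by (simp add: N_def del: of_nat_Suc)
qed

lemma mi_power_mult: "mi_power n (\<lambda>j. z j * w j) \<alpha> = mi_power n z \<alpha> * mi_power n w \<alpha>"
  by (simp add: mi_power_def power_mult_distrib prod.distrib)

lemma mi_power_cnj: "mi_power n (\<lambda>j. cnj (z j)) \<alpha> = cnj (mi_power n z \<alpha>)"
  by (simp add: mi_power_def)

lemma cmod_mi_power_unimodular: "(\<And>j. cmod (\<omega> j) = 1) \<Longrightarrow> cmod (mi_power n \<omega> \<alpha>) = 1"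
  by (simp add: mi_power_def norm_power flip: prod_norm)

text \<open>
  Parseval's inequality on the torus through \<open>z\<close>. The series converges absolutely there, so outside
  a finite set \<open>F\<close> of multi-indices its sum is at most \<open>\<epsilon>\<close> uniformly on the torus; the part over \<open>F\<close>
  is a trigonometric polynomial bounded by \<open>1 + \<epsilon>\<close>. The index \<open>\<alpha> = 0\<close> is excluded from \<open>G\<close> because there
  the analytic and the conjugate term have the same frequency.
\<close>

lemma expansion_l2_bound:
  assumes exp: "has_expansion_on n U f a b" and b0: "b (\<lambda>_. 0) = 0"
    and bound: "\<And>w. w \<in> U \<Longrightarrow> cmod (f w) \<le> 1"
    and torus: "\<And>\<omega>. (\<And>j. cmod (\<omega> j) = 1) \<Longrightarrow> (\<lambda>j. z j * \<omega> j) \<in> U"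
    and G: "finite G" "G \<subseteq> multi_indices n" "(\<lambda>_. 0) \<notin> G"
  shows "(\<Sum>\<alpha>\<in>G. ((cmod (a \<alpha>))\<^sup>2 + (cmod (b \<alpha>))\<^sup>2) * (cmod (mi_power n z \<alpha>))\<^sup>2) \<le> 1"
proof -
  let ?I = "multi_indices n" and ?o = "(\<lambda>_. 0) :: nat \<Rightarrow> nat"
  define A where "A = (\<lambda>\<alpha>. a \<alpha> * mi_power n z \<alpha>)"
  define B where "B = (\<lambda>\<alpha>. b \<alpha> * mi_power n z \<alpha>)"
  define h where "h = (\<lambda>\<alpha>. cmod (A \<alpha>) + cmod (B \<alpha>))"
  let ?S = "\<Sum>\<alpha>\<in>G. ((cmod (a \<alpha>))\<^sup>2 + (cmod (b \<alpha>))\<^sup>2) * (cmod (mi_power n z \<alpha>))\<^sup>2"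
  have S_eq: "?S = (\<Sum>\<alpha>\<in>G. (cmod (A \<alpha>))\<^sup>2 + (cmod (B \<alpha>))\<^sup>2)"
    by (simp add: A_def B_def norm_mult power_mult_distrib distrib_right)
  have zU: "z \<in> U" using torus[of "\<lambda>_. 1"] by simp
  have B_cnj: "cnj (b \<alpha>) * mi_power n (\<lambda>j. cnj (z j)) \<alpha> = cnj (B \<alpha>)" for \<alpha>
    by (simp add: B_def mi_power_cnj)
  have "A summable_on ?I" "(\<lambda>\<alpha>. cnj (B \<alpha>)) summable_on ?I"
    using exp zU unfolding has_expansion_on_def A_def by (auto simp: B_cnj)
  then have "(\<lambda>\<alpha>. cmod (A \<alpha>)) summable_on ?I" "(\<lambda>\<alpha>. cmod (cnj (B \<alpha>))) summable_on ?I"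
    by (simp_all only: summable_on_iff_abs_summable_on_complex[symmetric])
  then have h_sum: "h summable_on ?I"
    unfolding h_def by (intro summable_on_add) simp_all
  have main: "sqrt ?S \<le> 1 + \<epsilon>" if "\<epsilon> > 0" for \<epsilon> :: real
  proof -
    obtain F0 where F0: "finite F0" "F0 \<subseteq> ?I" "dist (sum h F0) (infsum h ?I) \<le> \<epsilon>"
      using infsum_finite_approximation[OF h_sum \<open>\<epsilon> > 0\<close>] by blast
    define F where "F = insert ?o (F0 \<union> G)"
    have F: "finite F" "F \<subseteq> ?I" using F0 G by (auto simp: F_def multi_indices_def)
    have "sum h F0 \<le> sum h F" unfolding F_def
      using F0 G by (intro sum_mono2) (auto simp: h_def)
    moreover have "infsum h ?I = sum h F + infsum h (?I - F)"
    proof -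
      have "infsum h (?I - F) = infsum h ?I - infsum h F"
        using h_sum F by (intro infsum_Diff) auto
      then show ?thesis using F by simp
    qed
    ultimately have tail: "infsum h (?I - F) \<le> \<epsilon>"
      using F0(3) by (simp add: dist_real_def)
    have trig: "cmod (\<Sum>\<alpha>\<in>F. A \<alpha> * mi_power n \<omega> \<alpha> + cnj (B \<alpha> * mi_power n \<omega> \<alpha>)) \<le> 1 + \<epsilon>"
      if \<omega>: "\<And>j. cmod (\<omega> j) = 1" for \<omega>
    proof -
      define H where "H = (\<lambda>\<alpha>. A \<alpha> * mi_power n \<omega> \<alpha> + cnj (B \<alpha> * mi_power n \<omega> \<alpha>))"
      let ?w = "\<lambda>j. z j * \<omega> j"
      have wU: "?w \<in> U" by (rule torus[OF \<omega>])
      have t1: "a \<alpha> * mi_power n ?w \<alpha> = A \<alpha> * mi_power n \<omega> \<alpha>" for \<alpha>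
        by (simp add: A_def mi_power_mult)
      have t2: "cnj (b \<alpha>) * mi_power n (\<lambda>j. cnj (?w j)) \<alpha> = cnj (B \<alpha> * mi_power n \<omega> \<alpha>)" for \<alpha>
        by (simp only: B_def mi_power_cnj mi_power_mult complex_cnj_mult mult.assoc)
      have s: "(\<lambda>\<alpha>. A \<alpha> * mi_power n \<omega> \<alpha>) summable_on ?I"
              "(\<lambda>\<alpha>. cnj (B \<alpha> * mi_power n \<omega> \<alpha>)) summable_on ?I"
        and "f ?w = (\<Sum>\<^sub>\<infinity>\<alpha>\<in>?I. A \<alpha> * mi_power n \<omega> \<alpha>) + (\<Sum>\<^sub>\<infinity>\<alpha>\<in>?I. cnj (B \<alpha> * mi_power n \<omega> \<alpha>))"
        using bspec[OF exp[unfolded has_expansion_on_def] wU] unfolding t1 t2 by blast+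
      then have f_eq: "f ?w = infsum H ?I" unfolding H_def by (simp add: infsum_add)
      have H_sum: "H summable_on ?I" unfolding H_def by (intro summable_on_add s)
      have Hh: "cmod (H \<alpha>) \<le> h \<alpha>" for \<alpha>
        unfolding H_def h_def
        by (rule order_trans[OF norm_triangle_ineq]) (simp add: norm_mult cmod_mi_power_unimodular[OF \<omega>])
      have "infsum H (?I - F) = infsum H ?I - infsum H F"
        using H_sum F by (intro infsum_Diff) auto
      then have "sum H F = f ?w - infsum H (?I - F)" using F f_eq by simp
      moreover have "cmod (infsum H (?I - F)) \<le> infsum h (?I - F)"
      proof (rule norm_infsum_le)
        show "(H has_sum infsum H (?I - F)) (?I - F)"
          using summable_on_subset_banach[OF H_sum] by (intro has_sum_infsum) auto
        show "(h has_sum infsum h (?I - F)) (?I - F)"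
          using summable_on_subset_banach[OF h_sum] by (intro has_sum_infsum) auto
      qed (use Hh in auto)
      moreover have "cmod (f ?w - infsum H (?I - F)) \<le> cmod (f ?w) + cmod (infsum H (?I - F))"
        by (rule norm_triangle_ineq4)
      ultimately have "cmod (sum H F) \<le> 1 + \<epsilon>"
        using bound[OF wU] tail by simp
      then show ?thesis by (simp add: H_def)
    qed
    \<comment> \<open>Multiplication by \<open>\<omega>\<^sub>1\<^sup>M \<dots> \<omega>\<^sub>n\<^sup>M\<close> makes all exponents natural numbers without changing the modulus.\<close>
    define M where "M = (\<Sum>\<alpha>\<in>F. \<Sum>j<n. \<alpha> j)"
    have M: "\<alpha> j \<le> M" if "\<alpha> \<in> F" "j < n" for \<alpha> j
    proof -
      have "\<alpha> j \<le> (\<Sum>j<n. \<alpha> j)" using that by (intro member_le_sum) auto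
      also have "\<dots> \<le> M" unfolding M_def
        using that F by (intro member_le_sum[where f = "\<lambda>\<alpha>. \<Sum>j<n. \<alpha> j"]) auto
      finally show ?thesis .
    qed
    \<comment> \<open>The monomial \<open>\<omega>\<^sup>\<alpha>\<close> becomes the frequency \<open>M + \<alpha>\<close> and its conjugate becomes \<open>M - \<alpha>\<close>; they coincide only for \<open>\<alpha> = 0\<close>.\<close>
    define X where "X = F \<times> {True} \<union> (F - {?o}) \<times> {False}"
    define c where "c = (\<lambda>x. if snd x then A (fst x) else cnj (B (fst x)))"
    define \<gamma> where "\<gamma> = (\<lambda>(x :: (nat \<Rightarrow> nat) \<times> bool) (j :: nat). if snd x then M + fst x j else M - fst x j)"
    have split: "(\<Sum>x\<in>X. g x) = (\<Sum>\<alpha>\<in>F. g (\<alpha>, True)) + (\<Sum>\<alpha>\<in>F - {?o}. g (\<alpha>, False))"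
      for g :: "(nat \<Rightarrow> nat) \<times> bool \<Rightarrow> 'b :: comm_monoid_add"
    proof -
      have "(\<Sum>x\<in>X. g x) = (\<Sum>x\<in>F \<times> {True}. g x) + (\<Sum>x\<in>(F - {?o}) \<times> {False}. g x)"
        unfolding X_def using F by (intro sum.union_disjoint) auto
      moreover have "(\<Sum>x\<in>Y \<times> {v}. g x) = (\<Sum>\<alpha>\<in>Y. g (\<alpha>, v))" for Y and v :: bool
        by (rule sum.reindex_bij_witness[where i = "\<lambda>\<alpha>. (\<alpha>, v)" and j = fst]) auto
      ultimately show ?thesis by simp
    qed
    have "(\<Sum>x\<in>X. (cmod (c x))\<^sup>2) \<le> (1 + \<epsilon>)\<^sup>2"
    proof (rule torus_bound_imp_l2_bound[where n = n and \<gamma> = \<gamma>])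
      show "finite X" using F by (simp add: X_def)
    next
      fix x y assume xy: "x \<in> X" "y \<in> X" "x \<noteq> y"
      show "\<exists>j<n. \<gamma> x j \<noteq> \<gamma> y j"
      proof (rule ccontr)
        assume neg: "\<not> (\<exists>j<n. \<gamma> x j \<noteq> \<gamma> y j)"
        have inF: "fst x \<in> F" "fst y \<in> F" using xy by (auto simp: X_def)
        have ext: "\<alpha> = \<beta>" if "\<alpha> \<in> F" "\<beta> \<in> F" "\<And>j. j < n \<Longrightarrow> \<alpha> j = \<beta> j" for \<alpha> \<beta>
        proof
          fix j show "\<alpha> j = \<beta> j"
            using that(3)[of j] subsetD[OF F(2) that(1)] subsetD[OF F(2) that(2)]
            by (cases "j < n") (auto simp: multi_indices_def)
        qed
        show False
        proof (cases "snd x = snd y")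
          case True
          have "fst x j = fst y j" if "j < n" for j
            using neg that True M[OF inF(1) that] M[OF inF(2) that]
            by (auto simp: \<gamma>_def split: if_splits)
          then have "fst x = fst y" by (intro ext inF) auto
          then show False using True xy(3) by (simp add: prod_eq_iff)
        next
          case False
          have zero: "fst x j = 0 \<and> fst y j = 0" if "j < n" for j
          proof -
            have "\<gamma> x j = \<gamma> y j" using neg that by blast
            then show ?thesis using False M[OF inF(1) that] M[OF inF(2) that]
              by (auto simp: \<gamma>_def split: if_splits)
          qed
          have "?o \<in> F" by (simp add: F_def)
          then have "fst x = ?o" "fst y = ?o" using zero by (auto intro!: ext inF)
          then show False using False xy(1,2) by (auto simp: X_def)
        qed
      qed
    next
      fix \<omega> :: "nat \<Rightarrow> complex" assume \<omega>: "\<And>j. cmod (\<omega> j) = 1"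
      define P where "P = (\<Prod>j<n. \<omega> j ^ M)"
      have P: "cmod P = 1" unfolding P_def by (simp add: norm_power \<omega> flip: prod_norm)
      have pT: "(\<Prod>j<n. \<omega> j ^ \<gamma> (\<alpha>, True) j) = P * mi_power n \<omega> \<alpha>" for \<alpha>
        by (simp add: \<gamma>_def P_def mi_power_def power_add prod.distrib)
      have pF: "(\<Prod>j<n. \<omega> j ^ \<gamma> (\<alpha>, False) j) = P * cnj (mi_power n \<omega> \<alpha>)" if "\<alpha> \<in> F" for \<alpha>
      proof -
        have "\<omega> j ^ (M - \<alpha> j) = \<omega> j ^ M * cnj (\<omega> j ^ \<alpha> j)" if "j < n" for j
        proof -
          have one: "\<omega> j ^ \<alpha> j * cnj (\<omega> j ^ \<alpha> j) = 1"
            using \<omega>[of j] by (simp add: complex_norm_square[symmetric] norm_power del: complex_cnj_power)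
          have "\<omega> j ^ M = \<omega> j ^ (M - \<alpha> j) * \<omega> j ^ \<alpha> j"
            using M[OF \<open>\<alpha> \<in> F\<close> that] by (simp add: power_add[symmetric])
          then show ?thesis using one by (simp add: mult.assoc)
        qed
        then show ?thesis
          by (simp add: \<gamma>_def P_def mi_power_def prod.distrib[symmetric])
      qed
      have "(\<Sum>x\<in>X. c x * (\<Prod>j<n. \<omega> j ^ \<gamma> x j)) =
          (\<Sum>\<alpha>\<in>F. A \<alpha> * (P * mi_power n \<omega> \<alpha>)) + (\<Sum>\<alpha>\<in>F - {?o}. cnj (B \<alpha>) * (P * cnj (mi_power n \<omega> \<alpha>)))"
        unfolding split by (simp add: c_def pT pF)
      also have "(\<Sum>\<alpha>\<in>F - {?o}. cnj (B \<alpha>) * (P * cnj (mi_power n \<omega> \<alpha>)))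
          = (\<Sum>\<alpha>\<in>F. cnj (B \<alpha>) * (P * cnj (mi_power n \<omega> \<alpha>)))"
        using F b0 by (intro sum.mono_neutral_left) (auto simp: B_def)
      also have "(\<Sum>\<alpha>\<in>F. A \<alpha> * (P * mi_power n \<omega> \<alpha>)) + \<dots>
          = P * (\<Sum>\<alpha>\<in>F. A \<alpha> * mi_power n \<omega> \<alpha> + cnj (B \<alpha> * mi_power n \<omega> \<alpha>))"
        by (simp add: sum_distrib_left sum.distrib distrib_left mult_ac)
      finally show "cmod (\<Sum>x\<in>X. c x * (\<Prod>j<n. \<omega> j ^ \<gamma> x j)) \<le> 1 + \<epsilon>"
        using trig[OF \<omega>] P by (simp add: norm_mult)
    qed
    moreover have "(\<Sum>x\<in>X. (cmod (c x))\<^sup>2) = (\<Sum>\<alpha>\<in>F. (cmod (A \<alpha>))\<^sup>2) + (\<Sum>\<alpha>\<in>F - {?o}. (cmod (B \<alpha>))\<^sup>2)"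
      unfolding split by (simp add: c_def)
    moreover have "(\<Sum>\<alpha>\<in>G. (cmod (A \<alpha>))\<^sup>2) \<le> (\<Sum>\<alpha>\<in>F. (cmod (A \<alpha>))\<^sup>2)"
      using F by (intro sum_mono2) (auto simp: F_def)
    moreover have "(\<Sum>\<alpha>\<in>G. (cmod (B \<alpha>))\<^sup>2) \<le> (\<Sum>\<alpha>\<in>F - {?o}. (cmod (B \<alpha>))\<^sup>2)"
      using F G by (intro sum_mono2) (auto simp: F_def)
    ultimately have "?S \<le> (1 + \<epsilon>)\<^sup>2" unfolding S_eq by (simp add: sum.distrib)
    then show ?thesis using \<open>\<epsilon> > 0\<close> by (intro real_le_lsqrt) auto
  qed
  have "sqrt ?S \<le> 1" by (rule field_le_epsilon) (rule main)
  then show ?thesis by simp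
qed

section \<open>The lower bound\<close>

lemma finite_multi_indices_degree: "finite {\<alpha>. \<alpha> \<in> multi_indices n \<and> mi_degree n \<alpha> = k}"
proof (rule finite_subset)
  show "{\<alpha>. \<alpha> \<in> multi_indices n \<and> mi_degree n \<alpha> = k}
      \<subseteq> {\<alpha>. \<forall>j. (j \<in> {..<n} \<longrightarrow> \<alpha> j \<in> {..k}) \<and> (j \<notin> {..<n} \<longrightarrow> \<alpha> j = 0)}"
    by (auto simp: multi_indices_def mi_degree_def intro: member_le_sum)
qed (rule finite_set_of_finite_funs; simp)

lemma sum_degree_le_prod_sum:
  fixes F :: "nat \<Rightarrow> nat \<Rightarrow> real"
  assumes "\<And>j i. 0 \<le> F j i"
  shows "(\<Sum>\<alpha> | \<alpha> \<in> multi_indices n \<and> mi_degree n \<alpha> = k. \<Prod>j<n. F j (\<alpha> j)) \<le> (\<Prod>j<n. \<Sum>i\<le>k. F j i)"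
proof -
  let ?D = "{\<alpha>. \<alpha> \<in> multi_indices n \<and> mi_degree n \<alpha> = k}"
  let ?r = "\<lambda>\<alpha> :: nat \<Rightarrow> nat. restrict \<alpha> {..<n}"
  have inj: "inj_on ?r ?D"
  proof (intro inj_onI ext)
    fix \<alpha> \<beta> j assume "\<alpha> \<in> ?D" "\<beta> \<in> ?D" "?r \<alpha> = ?r \<beta>"
    then show "\<alpha> j = \<beta> j"
      by (cases "j < n") (auto simp: multi_indices_def dest: fun_cong[of _ _ j])
  qed
  have "(\<Sum>\<alpha>\<in>?D. \<Prod>j<n. F j (\<alpha> j)) = (\<Sum>g\<in>?r ` ?D. \<Prod>j<n. F j (g j))"
    by (simp add: sum.reindex[OF inj])
  also have "\<dots> \<le> (\<Sum>g\<in>PiE {..<n} (\<lambda>_. {..k}). \<Prod>j<n. F j (g j))"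
  proof (rule sum_mono2)
    show "?r ` ?D \<subseteq> PiE {..<n} (\<lambda>_. {..k})"
      by (auto simp: mi_degree_def PiE_iff extensional_def split: if_splits intro: member_le_sum)
  qed (auto intro!: finite_PiE prod_nonneg assms)
  also have "\<dots> = (\<Prod>j<n. \<Sum>i\<le>k. F j i)" by (rule prod_sum_PiE[symmetric]) auto
  finally show ?thesis .
qed

text \<open>
  Replacing \<open>i\<^sup>i\<close> by \<open>i!\<close> only increases the terms, and dropping the condition on the degree leaves a
  product of partial sums of exponential series.
\<close>

lemma sum_degree_le_exp:
  fixes x :: "nat \<Rightarrow> real"
  assumes "\<And>j. 0 \<le> x j"
  shows "(\<Sum>\<alpha> | \<alpha> \<in> multi_indices n \<and> mi_degree n \<alpha> = k. \<Prod>j<n. x j ^ \<alpha> j / real (\<alpha> j ^ \<alpha> j))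
           \<le> exp (\<Sum>j<n. x j)"
proof -
  have le: "(\<Sum>i\<le>k. x j ^ i / real (i ^ i)) \<le> exp (x j)" for j
  proof -
    have "(\<Sum>i\<le>k. x j ^ i / real (i ^ i)) \<le> (\<Sum>i\<le>k. x j ^ i /\<^sub>R fact i)"
    proof (rule sum_mono)
      fix i
      have "(fact i :: real) \<le> real (i ^ i)" using fact_le_power[of i, where 'a = real] by simp
      then show "x j ^ i / real (i ^ i) \<le> x j ^ i /\<^sub>R fact i"
        using assms[of j] by (simp add: divide_inverse_commute mult_right_mono le_imp_inverse_le)
    qed
    also have "\<dots> \<le> (\<Sum>i. x j ^ i /\<^sub>R fact i)"
      using assms[of j] exp_converges[of "x j"] by (intro sum_le_suminf) (auto simp: sums_iff)
    finally show ?thesis by (simp add: exp_def)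
  qed
  have "(\<Sum>\<alpha> | \<alpha> \<in> multi_indices n \<and> mi_degree n \<alpha> = k. \<Prod>j<n. x j ^ \<alpha> j / real (\<alpha> j ^ \<alpha> j))
      \<le> (\<Prod>j<n. \<Sum>i\<le>k. x j ^ i / real (i ^ i))"
    by (rule sum_degree_le_prod_sum) (simp add: assms)
  also have "\<dots> \<le> (\<Prod>j<n. exp (x j))"
    using le assms by (intro prod_mono) (auto intro!: sum_nonneg)
  finally show ?thesis by (simp add: exp_sum)
qed

lemma prod_power_degree: "mi_degree n \<alpha> = k \<Longrightarrow> (\<Prod>j<n. (c :: real) ^ \<alpha> j) = c ^ k"
  by (simp add: mi_degree_def power_sum[symmetric])

text \<open>
  With \<open>x\<^sub>j = k / n\<close> in \<open>sum_degree_le_exp\<close> every term is at least \<open>n\<^sup>-\<^sup>k\<close>, and the sum is at most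
  \<open>e\<^sup>k\<close>.
\<close>

lemma card_multi_indices_degree_le:
  assumes "1 \<le> n"
  shows "real (card {\<alpha>. \<alpha> \<in> multi_indices n \<and> mi_degree n \<alpha> = k}) \<le> exp (real k) * real n ^ k"
proof -
  let ?D = "{\<alpha>. \<alpha> \<in> multi_indices n \<and> mi_degree n \<alpha> = k}"
  have "1 / real n ^ k \<le> (\<Prod>j<n. (real k / real n) ^ \<alpha> j / real (\<alpha> j ^ \<alpha> j))" if "\<alpha> \<in> ?D" for \<alpha>
  proof -
    have deg: "mi_degree n \<alpha> = k" using that by simp
    have "(1 / real n) ^ \<alpha> j \<le> (real k / real n) ^ \<alpha> j / real (\<alpha> j ^ \<alpha> j)" if "j < n" for j
    proof -
      have "\<alpha> j \<le> k" using that deg by (auto simp: mi_degree_def intro: member_le_sum)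
      then have "real (\<alpha> j) ^ \<alpha> j \<le> real k ^ \<alpha> j" by (intro power_mono) auto
      moreover have "0 < real (\<alpha> j ^ \<alpha> j)" by (cases "\<alpha> j = 0") auto
      ultimately show ?thesis using \<open>1 \<le> n\<close> by (simp add: power_divide field_simps)
    qed
    then have "(\<Prod>j<n. (1 / real n) ^ \<alpha> j) \<le> (\<Prod>j<n. (real k / real n) ^ \<alpha> j / real (\<alpha> j ^ \<alpha> j))"
      by (intro prod_mono) auto
    then show ?thesis unfolding prod_power_degree[OF deg] by (simp add: power_divide)
  qed
  then have "(\<Sum>\<alpha>\<in>?D. 1 / real n ^ k) \<le> (\<Sum>\<alpha>\<in>?D. \<Prod>j<n. (real k / real n) ^ \<alpha> j / real (\<alpha> j ^ \<alpha> j))"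
    by (intro sum_mono)
  also have "\<dots> \<le> exp (\<Sum>j<n. real k / real n)" by (rule sum_degree_le_exp) simp
  finally show ?thesis using \<open>1 \<le> n\<close> by (simp add: field_simps)
qed

lemma power_powr_commute: "0 \<le> y \<Longrightarrow> ((y :: real) ^ a) powr s = (y powr s) ^ a"
  by (induction a) (auto simp: powr_mult)

lemma cmod_mi_power: "cmod (mi_power n z \<alpha>) = (\<Prod>j<n. cmod (z j) ^ \<alpha> j)"
  by (simp add: mi_power_def norm_power flip: prod_norm)

lemma lp_ball_torus_invariant:
  assumes "z \<in> lp_ball n p \<rho>" "\<And>j. cmod (\<omega> j) = 1"
  shows "(\<lambda>j. z j * \<omega> j) \<in> lp_ball n p \<rho>"
proof -
  have "lp_norm n p (\<lambda>j. z j * \<omega> j) = lp_norm n p z"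
    by (rule lp_norm_cong) (simp add: norm_mult assms(2))
  then show ?thesis using assms(1) by (auto simp: lp_ball_def cspace_def)
qed

locale bounded_expansion =
  fixes n :: nat and p :: ereal and f :: "(nat \<Rightarrow> complex) \<Rightarrow> complex" and a b :: "(nat \<Rightarrow> nat) \<Rightarrow> complex"
  assumes n1: "1 \<le> n" and p1: "1 \<le> p"
    and expansion: "has_expansion_on n (lp_ball n p 1) f a b"
    and b0: "b (\<lambda>_. 0) = 0"
    and bounded: "\<And>z. z \<in> lp_ball n p 1 \<Longrightarrow> cmod (f z) \<le> 1"
begin

lemma l2_bound:
  assumes "z \<in> lp_ball n p 1" "finite G" "G \<subseteq> multi_indices n" "(\<lambda>_. 0) \<notin> G"
  shows "(\<Sum>\<alpha>\<in>G. ((cmod (a \<alpha>))\<^sup>2 + (cmod (b \<alpha>))\<^sup>2) * (cmod (mi_power n z \<alpha>))\<^sup>2) \<le> 1"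
  by (rule expansion_l2_bound[OF expansion b0 bounded])
    (use assms lp_ball_torus_invariant in auto)

text \<open>
  The Cauchy-Schwarz inequality. The estimate holds for every \<open>p\<close>, but it is of the right order only for
  \<open>p \<ge> 2\<close>.
\<close>

lemma homogeneous_part_bound_sqrt:
  assumes w: "w \<in> lp_ball n p 1" and k: "1 \<le> k"
  shows "bohr_term n a b w k \<le> 2 * (exp 1 * real n powr (1 / 2)) ^ k"
proof (rule power2_le_imp_le)
  let ?D = "{\<alpha>. \<alpha> \<in> multi_indices n \<and> mi_degree n \<alpha> = k}"
  have "(bohr_term n a b w k)\<^sup>2
      \<le> real (card ?D) * (\<Sum>\<alpha>\<in>?D. ((cmod (a \<alpha>) + cmod (b \<alpha>)) * cmod (mi_power n w \<alpha>))\<^sup>2)"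
    unfolding bohr_term_def using sum_squared_le_sum_of_squares by (simp add: mult.commute)
  also have "(\<Sum>\<alpha>\<in>?D. ((cmod (a \<alpha>) + cmod (b \<alpha>)) * cmod (mi_power n w \<alpha>))\<^sup>2)
      \<le> (\<Sum>\<alpha>\<in>?D. 2 * (((cmod (a \<alpha>))\<^sup>2 + (cmod (b \<alpha>))\<^sup>2) * (cmod (mi_power n w \<alpha>))\<^sup>2))"
  proof (rule sum_mono)
    fix \<alpha>
    have "(cmod (a \<alpha>) + cmod (b \<alpha>))\<^sup>2 \<le> 2 * ((cmod (a \<alpha>))\<^sup>2 + (cmod (b \<alpha>))\<^sup>2)"
      using sum_squares_bound[of "cmod (a \<alpha>)" "cmod (b \<alpha>)"] by (simp add: power2_sum)
    then have "(cmod (a \<alpha>) + cmod (b \<alpha>))\<^sup>2 * (cmod (mi_power n w \<alpha>))\<^sup>2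
        \<le> 2 * ((cmod (a \<alpha>))\<^sup>2 + (cmod (b \<alpha>))\<^sup>2) * (cmod (mi_power n w \<alpha>))\<^sup>2"
      by (intro mult_right_mono) auto
    then show "((cmod (a \<alpha>) + cmod (b \<alpha>)) * cmod (mi_power n w \<alpha>))\<^sup>2
        \<le> 2 * (((cmod (a \<alpha>))\<^sup>2 + (cmod (b \<alpha>))\<^sup>2) * (cmod (mi_power n w \<alpha>))\<^sup>2)"
      by (simp only: power_mult_distrib mult.assoc)
  qed
  also have "\<dots> = 2 * (\<Sum>\<alpha>\<in>?D. ((cmod (a \<alpha>))\<^sup>2 + (cmod (b \<alpha>))\<^sup>2) * (cmod (mi_power n w \<alpha>))\<^sup>2)"
    by (simp add: sum_distrib_left)
  also have "\<dots> \<le> 2 * 1"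
    using k by (intro mult_left_mono l2_bound w finite_multi_indices_degree) (auto simp: mi_degree_def)
  also have "real (card ?D) * (2 * 1) \<le> exp (real k) * real n ^ k * 2"
    using card_multi_indices_degree_le[OF n1, of k] by simp
  also have "\<dots> \<le> (exp (real k))\<^sup>2 * real n ^ k * 4"
  proof -
    have "exp (real k) * 1 \<le> exp (real k) * exp (real k)" by (intro mult_left_mono) auto
    then have "exp (real k) * real n ^ k \<le> (exp (real k))\<^sup>2 * real n ^ k"
      unfolding power2_eq_square by (intro mult_right_mono) auto
    moreover have "0 \<le> exp (real k) * real n ^ k" by simp
    ultimately show ?thesis by linarith
  qed
  also have "\<dots> = (2 * (exp 1 * real n powr (1 / 2)) ^ k)\<^sup>2"
    using n1 by (simp add: power_mult_distrib exp_of_nat_mult[symmetric] powr_half_sqrt flip: power_mult)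
      (simp add: power_mult mult.commute[of k 2])
  finally show "(bohr_term n a b w k)\<^sup>2 \<le> (2 * (exp 1 * real n powr (1 / 2)) ^ k)\<^sup>2"
    by (simp add: mult_left_mono)
qed simp

text \<open>
  Cauchy's estimate. On the boundary of the ball \<open>\<bar>v\<^sup>\<alpha>\<bar>\<close> is largest where \<open>\<bar>v\<^sub>j\<bar>\<^sup>r = \<alpha>\<^sub>j / k\<close>; the factor
  \<open>1/2\<close> in the point used moves it into the open ball, at the cost of the factor \<open>2\<^sup>k\<close>.
\<close>

lemma coefficient_bound:
  assumes r: "p = ereal r" "1 \<le> r" and k: "1 \<le> k"
    and \<alpha>: "\<alpha> \<in> multi_indices n" "mi_degree n \<alpha> = k"
  shows "cmod (a \<alpha>) \<le> 2 ^ k * (\<Prod>j<n. real k ^ \<alpha> j / real (\<alpha> j ^ \<alpha> j)) powr (1 / r)" (is ?A)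
    and "cmod (b \<alpha>) \<le> 2 ^ k * (\<Prod>j<n. real k ^ \<alpha> j / real (\<alpha> j ^ \<alpha> j)) powr (1 / r)" (is ?B)
proof -
  define X where "X = (\<Prod>j<n. real k ^ \<alpha> j / real (\<alpha> j ^ \<alpha> j))"
  have "0 < real k ^ \<alpha> j / real (\<alpha> j ^ \<alpha> j)" for j
    using k by (cases "\<alpha> j = 0") auto
  then have X: "0 < X" unfolding X_def by (intro prod_pos) auto
  define v where "v = (\<lambda>j. complex_of_real (1 / 2 * (real (\<alpha> j) / real k) powr (1 / r)))"
  have cv: "cmod (v j) = 1 / 2 * (real (\<alpha> j) / real k) powr (1 / r)" for j
    unfolding v_def norm_of_real by simp
  have "v \<in> lp_ball n p 1"
  proof -
    have "(\<Sum>j<n. cmod (v j) powr r) = (\<Sum>j<n. (1 / 2) powr r * (real (\<alpha> j) / real k))"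
    proof (rule sum.cong[OF refl])
      fix j
      have "cmod (v j) powr r = (1 / 2) powr r * ((real (\<alpha> j) / real k) powr (1 / r)) powr r"
        unfolding cv by (rule powr_mult)
      then show "cmod (v j) powr r = (1 / 2) powr r * (real (\<alpha> j) / real k)"
        using r by (simp add: powr_powr)
    qed
    also have "\<dots> = (1 / 2) powr r * ((\<Sum>j<n. real (\<alpha> j)) / real k)"
      by (simp add: sum_distrib_left sum_divide_distrib)
    also have "(\<Sum>j<n. real (\<alpha> j)) = real k" using \<alpha>(2) by (simp add: mi_degree_def flip: of_nat_sum)
    also have "(1 / 2) powr r * (real k / real k) = (1 / 2) powr r" using k by simp
    also have "\<dots> < 1" using powr_less_mono2[of r "1 / 2" 1] r by simp
    finally have "(\<Sum>j<n. cmod (v j) powr r) < 1" .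
    moreover have "v \<in> cspace n" using \<alpha>(1) by (auto simp: v_def cspace_def multi_indices_def)
    ultimately show ?thesis using r by (simp add: lp_ball_finite_exponent)
  qed
  then have le: "(\<Sum>\<alpha>\<in>{\<alpha>}. ((cmod (a \<alpha>))\<^sup>2 + (cmod (b \<alpha>))\<^sup>2) * (cmod (mi_power n v \<alpha>))\<^sup>2) \<le> 1"
    using \<alpha> k by (intro l2_bound) (auto simp: mi_degree_def)
  have "cmod (mi_power n v \<alpha>) = (\<Prod>j<n. (1 / 2) ^ \<alpha> j * (real (\<alpha> j ^ \<alpha> j) / real k ^ \<alpha> j) powr (1 / r))"
    unfolding cmod_mi_power cv power_mult_distrib
    by (simp add: power_powr_commute[symmetric] power_divide)
  also have "\<dots> = (1 / 2) ^ k * (\<Prod>j<n. real (\<alpha> j ^ \<alpha> j) / real k ^ \<alpha> j) powr (1 / r)"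
    unfolding prod.distrib prod_power_degree[OF \<alpha>(2)] by (subst prod_powr_distrib) auto
  also have "(\<Prod>j<n. real (\<alpha> j ^ \<alpha> j) / real k ^ \<alpha> j) = 1 / X"
    unfolding X_def by (simp add: prod_dividef)
  finally have m: "cmod (mi_power n v \<alpha>) = (1 / 2) ^ k * (1 / X) powr (1 / r)" .
  define M where "M = cmod (mi_power n v \<alpha>)"
  have inv: "2 ^ k * X powr (1 / r) * M = 1" "0 < M"
    unfolding M_def m using X by (auto simp: powr_divide power_divide)
  have "((cmod c)\<^sup>2 * M\<^sup>2 \<le> 1) \<Longrightarrow> cmod c \<le> 2 ^ k * X powr (1 / r)" for c
  proof -
    assume "(cmod c)\<^sup>2 * M\<^sup>2 \<le> 1"
    then have "(cmod c * M)\<^sup>2 \<le> 1\<^sup>2" by (simp add: power_mult_distrib)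
    then have "cmod c * M \<le> 1" by (rule power2_le_imp_le) simp
    also have "1 = 2 ^ k * X powr (1 / r) * M" using inv by simp
    finally show ?thesis using inv(2) by (rule mult_right_le_imp_le)
  qed
  moreover have "(cmod (a \<alpha>))\<^sup>2 * M\<^sup>2 \<le> 1" "(cmod (b \<alpha>))\<^sup>2 * M\<^sup>2 \<le> 1"
    using le by (auto simp: M_def distrib_right intro: order_trans[rotated])
  ultimately show ?A ?B unfolding X_def by blast+
qed

text \<open>
  After Cauchy's estimate the \<open>\<alpha>\<close>-term is a multiple of \<open>X\<^sub>\<alpha>\<^bsup>1/r\<^esup>\<close>, where
  \<open>X\<^sub>\<alpha> = \<Prod>\<^sub>j (k \<bar>w\<^sub>j\<bar>\<^sup>r)\<^bsup>\<alpha>\<^sub>j\<^esup> / \<alpha>\<^sub>j\<^bsup>\<alpha>\<^sub>j\<^esup>\<close> has sum at most \<open>e\<^sup>k\<close>. Only the passage from \<open>X\<^sub>\<alpha>\<close> to its root costs a power of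
  the number \<open>(e n)\<^sup>k\<close> of terms.
\<close>

lemma homogeneous_part_bound_small_exponent:
  assumes r: "p = ereal r" "1 \<le> r" and w: "w \<in> lp_ball n p 1" and k: "1 \<le> k"
  shows "bohr_term n a b w k \<le> 2 * (2 * exp 1 * real n powr (1 - 1 / r)) ^ k"
proof -
  let ?D = "{\<alpha>. \<alpha> \<in> multi_indices n \<and> mi_degree n \<alpha> = k}"
  define X where "X = (\<lambda>\<alpha>. \<Prod>j<n. (real k * cmod (w j) powr r) ^ \<alpha> j / real (\<alpha> j ^ \<alpha> j))"
  have X0: "0 \<le> X \<alpha>" for \<alpha> unfolding X_def by (intro prod_nonneg) auto
  have "(\<Sum>j<n. cmod (w j) powr r) \<le> 1" using w r by (simp add: lp_ball_finite_exponent)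
  then have "real k * (\<Sum>j<n. cmod (w j) powr r) \<le> real k * 1" by (intro mult_left_mono) auto
  then have sumX: "(\<Sum>\<alpha>\<in>?D. X \<alpha>) \<le> exp (real k)"
    unfolding X_def
    by (intro order_trans[OF sum_degree_le_exp]) (auto simp: sum_distrib_left[symmetric])
  define y where "y = 1 / real n ^ k"
  have y: "0 < y" using n1 by (simp add: y_def)
  have sumy: "real (card ?D) * y \<le> exp (real k)"
    using card_multi_indices_degree_le[OF n1, of k] n1 by (simp add: y_def field_simps)
  have term_le: "(cmod (a \<alpha>) + cmod (b \<alpha>)) * cmod (mi_power n w \<alpha>) \<le> 2 * 2 ^ k * X \<alpha> powr (1 / r)"
    if "\<alpha> \<in> ?D" for \<alpha>
  proof -
    let ?Q = "\<Prod>j<n. real k ^ \<alpha> j / real (\<alpha> j ^ \<alpha> j)"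
    have Q0: "0 \<le> ?Q" by (intro prod_nonneg) auto
    have mw: "cmod (mi_power n w \<alpha>) = (\<Prod>j<n. (cmod (w j) powr r) ^ \<alpha> j) powr (1 / r)"
      unfolding cmod_mi_power using r
      by (subst prod_powr_distrib) (auto simp: power_powr_commute powr_powr)
    have "cmod (a \<alpha>) + cmod (b \<alpha>) \<le> 2 * 2 ^ k * ?Q powr (1 / r)"
      using coefficient_bound[OF r k, of \<alpha>] that by simp
    then have "(cmod (a \<alpha>) + cmod (b \<alpha>)) * cmod (mi_power n w \<alpha>)
        \<le> 2 * 2 ^ k * ?Q powr (1 / r) * cmod (mi_power n w \<alpha>)"
      by (intro mult_right_mono) auto
    also have "\<dots> = 2 * 2 ^ k * (?Q * (\<Prod>j<n. (cmod (w j) powr r) ^ \<alpha> j)) powr (1 / r)"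
      unfolding mw by (simp only: powr_mult mult.assoc)
    also have "?Q * (\<Prod>j<n. (cmod (w j) powr r) ^ \<alpha> j) = X \<alpha>"
      unfolding X_def prod.distrib[symmetric] by (simp add: power_mult_distrib)
    finally show ?thesis .
  qed
  \<comment> \<open>Hoelder's inequality for \<open>\<Sum> X\<^sub>\<alpha>\<^bsup>1/r\<^esup>\<close>, in the form of Young's inequality with the constant weight \<open>n\<^sup>-\<^sup>k\<close>.\<close>
  have "(\<Sum>\<alpha>\<in>?D. X \<alpha> powr (1 / r) * y powr (1 - 1 / r)) \<le> (\<Sum>\<alpha>\<in>?D. 1 / r * X \<alpha> + (1 - 1 / r) * y)"
    using r y X0 by (intro sum_mono Young_powr) auto
  also have "\<dots> = 1 / r * (\<Sum>\<alpha>\<in>?D. X \<alpha>) + (1 - 1 / r) * (real (card ?D) * y)"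
    by (simp add: sum.distrib sum_distrib_left)
  also have "\<dots> \<le> 1 / r * exp (real k) + (1 - 1 / r) * exp (real k)"
    using r sumX sumy by (intro add_mono mult_left_mono) auto
  also have "\<dots> = exp (real k)" by (simp add: algebra_simps)
  finally have "(\<Sum>\<alpha>\<in>?D. X \<alpha> powr (1 / r)) * y powr (1 - 1 / r) \<le> exp (real k)"
    by (simp add: sum_distrib_right)
  moreover have "y powr (1 - 1 / r) = 1 / (real n powr (1 - 1 / r)) ^ k"
    unfolding y_def by (simp add: powr_divide power_powr_commute)
  ultimately have S: "(\<Sum>\<alpha>\<in>?D. X \<alpha> powr (1 / r)) \<le> exp (real k) * (real n powr (1 - 1 / r)) ^ k"
    using n1 by (simp add: field_simps)
  have "bohr_term n a b w k \<le> (\<Sum>\<alpha>\<in>?D. 2 * 2 ^ k * X \<alpha> powr (1 / r))"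
    unfolding bohr_term_def by (intro sum_mono term_le)
  also have "\<dots> = 2 * 2 ^ k * (\<Sum>\<alpha>\<in>?D. X \<alpha> powr (1 / r))" by (simp add: sum_distrib_left)
  also have "\<dots> \<le> 2 * 2 ^ k * (exp (real k) * (real n powr (1 - 1 / r)) ^ k)"
    using S by (intro mult_left_mono) auto
  also have "\<dots> = 2 * (2 * exp 1 * real n powr (1 - 1 / r)) ^ k"
    by (simp add: power_mult_distrib exp_of_nat_mult[symmetric])
  finally show ?thesis .
qed

lemma homogeneous_part_bound:
  assumes w: "w \<in> lp_ball n p 1" and k: "1 \<le> k"
  shows "bohr_term n a b w k \<le> 2 * (2 * exp 1 * real n powr (1 - 1 / real_of_ereal (min p 2))) ^ k"
proof (cases "p \<le> 2")
  case True
  then obtain r where "p = ereal r" "1 \<le> r" using p1 by (cases p) auto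
  moreover have "min p 2 = p" using True by (simp add: min_def)
  ultimately show ?thesis using homogeneous_part_bound_small_exponent[of r w k] w k by simp
next
  case False
  then have q: "real_of_ereal (min p 2) = 2" by (simp add: min_def)
  have "bohr_term n a b w k \<le> 2 * (exp 1 * real n powr (1 / 2)) ^ k"
    by (rule homogeneous_part_bound_sqrt[OF w k])
  also have "\<dots> \<le> 2 * (2 * exp 1 * real n powr (1 / 2)) ^ k"
    by (intro mult_left_mono power_mono mult_right_mono) auto
  finally show ?thesis using q by simp
qed

lemma bohr_term_scale:
  assumes "0 \<le> c"
  shows "bohr_term n a b (\<lambda>j. of_real c * z j) k = c ^ k * bohr_term n a b z k"
proof -
  have "cmod (mi_power n (\<lambda>j. of_real c * z j) \<alpha>) = c ^ k * cmod (mi_power n z \<alpha>)"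
    if "mi_degree n \<alpha> = k" for \<alpha>
    unfolding cmod_mi_power prod_power_degree[OF that, symmetric] using assms
    by (simp add: norm_mult power_mult_distrib prod.distrib)
  then show ?thesis unfolding bohr_term_def sum_distrib_left
    by (intro sum.cong) auto
qed

lemma bohr_series_bound:
  assumes z: "z \<in> lp_ball n p \<rho>"
    and \<rho>: "\<rho> = 1 / 18 * (1 / real n) powr (1 - 1 / real_of_ereal (min p 2))"
  shows "summable (\<lambda>k. bohr_term n a b z (Suc k)) \<and> (\<Sum>k. bohr_term n a b z (Suc k)) \<le> 1"
proof -
  define N where "N = real n powr (1 - 1 / real_of_ereal (min p 2))"
  have N: "0 < N" "\<rho> = 1 / (18 * N)" using n1 by (auto simp: N_def \<rho> powr_divide)
  then have "0 < \<rho>" by simp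
  define w where "w = (\<lambda>j. of_real (1 / \<rho>) * z j)"
  have w: "w \<in> lp_ball n p 1"
    unfolding w_def by (rule lp_ball_scale[OF p1 n1 \<open>0 < \<rho>\<close> z])
  have zw: "z = (\<lambda>j. of_real \<rho> * w j)" using \<open>0 < \<rho>\<close> by (auto simp: w_def)
  have le: "bohr_term n a b z (Suc k) \<le> 2 / 3 * (1 / 3) ^ k" for k
  proof -
    have "bohr_term n a b z (Suc k) = \<rho> ^ Suc k * bohr_term n a b w (Suc k)"
      unfolding zw using \<open>0 < \<rho>\<close> by (intro bohr_term_scale) auto
    also have "\<dots> \<le> \<rho> ^ Suc k * (2 * (2 * exp 1 * N) ^ Suc k)"
      unfolding N_def using \<open>0 < \<rho>\<close> by (intro mult_left_mono homogeneous_part_bound w) auto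
    also have "\<dots> = 2 * (\<rho> * (2 * exp 1 * N)) ^ Suc k"
      by (simp only: power_mult_distrib mult_ac)
    \<comment> \<open>The constant \<open>1 / 18\<close> makes this ratio at most \<open>1 / 3\<close>, and \<open>2 \<Sum>\<^sub>k 3\<^sup>-\<^sup>k\<close> over \<open>k \<ge> 1\<close> is 1.\<close>
    also have "\<rho> * (2 * exp 1 * N) = exp 1 / 9" using N by simp
    also have "2 * (exp 1 / 9) ^ Suc k \<le> 2 * (1 / 3 :: real) ^ Suc k"
      using exp_le by (intro mult_left_mono power_mono) auto
    finally show ?thesis by simp
  qed
  have ge: "0 \<le> bohr_term n a b z (Suc k)" for k
    unfolding bohr_term_def by (intro sum_nonneg) auto
  have geo: "(\<lambda>k. 2 / 3 * (1 / 3 :: real) ^ k) sums (2 / 3 * (1 / (1 - 1 / 3)))"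
    by (intro sums_mult geometric_sums) auto
  have sm: "summable (\<lambda>k. bohr_term n a b z (Suc k))"
    by (rule summable_comparison_test_ev[OF _ sums_summable[OF geo]])
      (use le ge in \<open>auto intro!: always_eventually\<close>)
  moreover have "(\<Sum>k. bohr_term n a b z (Suc k)) \<le> (\<Sum>k. 2 / 3 * (1 / 3) ^ k)"
    by (rule suminf_le[OF le sm sums_summable[OF geo]])
  ultimately show ?thesis using sums_unique[OF geo] by simp
qed

end

lemma bohr_property_lower:
  assumes "1 \<le> p" "1 \<le> n"
  shows "bohr_property n p (1 / 18 * (1 / real n) powr (1 - 1 / real_of_ereal (min p 2)))"
  unfolding bohr_property_def
proof (intro allI impI ballI)
  fix f a b z
  assume "has_expansion_on n (lp_ball n p 1) f a b" "b (\<lambda>_. 0) = 0" "\<forall>z\<in>lp_ball n p 1. cmod (f z) \<le> 1"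
    and z: "z \<in> lp_ball n p (1 / 18 * (1 / real n) powr (1 - 1 / real_of_ereal (min p 2)))"
  then interpret bounded_expansion n p f a b using assms by unfold_locales auto
  show "summable (\<lambda>k. bohr_term n a b z (Suc k)) \<and> (\<Sum>k. bohr_term n a b z (Suc k)) \<le> 1"
    by (rule bohr_series_bound[OF z refl])
qed

section \<open>Sign tensors of small norm\<close>

text \<open>
  For \<open>y \<ge> 0\<close> the bound on \<open>e\<^sup>-\<^sup>y\<close> comes from \<open>(1 - y + y\<^sup>2) (1 + y) = 1 + y\<^sup>3 \<ge> 1\<close>.
\<close>

lemma exp_add_exp_minus_le:
  fixes x :: real
  assumes "\<bar>x\<bar> \<le> 1"
  shows "exp x + exp (- x) \<le> 2 * exp (x\<^sup>2)"
proof -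
  have main: "exp y + exp (- y) \<le> 2 * exp (y\<^sup>2)" if "0 \<le> y" "y \<le> 1" for y :: real
  proof -
    have "exp y \<le> 1 + y + y\<^sup>2" using that by (rule exp_bound)
    moreover have "exp (- y) \<le> 1 - y + y\<^sup>2"
    proof -
      have "1 \<le> (1 - y + y\<^sup>2) * (1 + y)"
        using that by (simp add: algebra_simps power2_eq_square)
      also have "\<dots> \<le> (1 - y + y\<^sup>2) * exp y"
        using that exp_ge_add_one_self[of y] by (intro mult_left_mono) auto
      finally show ?thesis by (simp add: exp_minus field_simps)
    qed
    moreover have "1 + y\<^sup>2 \<le> exp (y\<^sup>2)" by (rule exp_ge_add_one_self)
    ultimately show ?thesis by linarith
  qed
  show ?thesis using main[of "\<bar>x\<bar>"] assms by (cases "0 \<le> x") (auto simp: add.commute)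
qed

lemma sum_signs_exp_le:
  fixes c :: "'i \<Rightarrow> real"
  assumes "finite I" and c: "(\<Sum>i\<in>I. (c i)\<^sup>2) \<le> 1"
  shows "(\<Sum>\<epsilon>\<in>PiE I (\<lambda>_. {-1, 1}). exp (\<Sum>i\<in>I. \<epsilon> i * c i)) \<le> 2 ^ card I * exp 1"
proof -
  have "(\<Sum>\<epsilon>\<in>PiE I (\<lambda>_. {-1, 1}). exp (\<Sum>i\<in>I. \<epsilon> i * c i))
      = (\<Sum>\<epsilon>\<in>PiE I (\<lambda>_. {-1, 1}). \<Prod>i\<in>I. exp (\<epsilon> i * c i))"
    by (simp add: exp_sum \<open>finite I\<close>)
  also have "\<dots> = (\<Prod>i\<in>I. \<Sum>s\<in>{-1, 1}. exp (s * c i))"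
    using \<open>finite I\<close> by (intro prod_sum_PiE[symmetric]) auto
  also have "\<dots> \<le> (\<Prod>i\<in>I. 2 * exp ((c i)\<^sup>2))"
  proof (rule prod_mono)
    fix i assume "i \<in> I"
    then have "(c i)\<^sup>2 \<le> (\<Sum>i\<in>I. (c i)\<^sup>2)"
      using \<open>finite I\<close> by (intro member_le_sum) auto
    then have "\<bar>c i\<bar> \<le> 1" using c abs_square_le_1 by force
    then show "0 \<le> (\<Sum>s\<in>{-1, 1}. exp (s * c i)) \<and> (\<Sum>s\<in>{-1, 1}. exp (s * c i)) \<le> 2 * exp ((c i)\<^sup>2)"
      using exp_add_exp_minus_le[of "c i"] by (simp add: add.commute add_nonneg_nonneg)
  qed
  also have "\<dots> = 2 ^ card I * exp (\<Sum>i\<in>I. (c i)\<^sup>2)"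
    by (simp add: prod.distrib exp_sum \<open>finite I\<close>)
  also have "\<dots> \<le> 2 ^ card I * exp 1" using c by simp
  finally show ?thesis .
qed

text \<open>
  The average over all signs of \<open>\<Sum>\<^sub>x exp (\<Sum>\<^sub>i \<epsilon>\<^sub>i c\<^sub>x\<^sub>,\<^sub>i)\<close> is at most \<open>e \<cdot> card K\<close>. Signs for which the value
  does not exceed the average control all exponentials at once.
\<close>

lemma exists_signs_all_sums_small:
  fixes c :: "'k \<Rightarrow> 'i \<Rightarrow> real"
  assumes "finite I" "finite K" and c: "\<And>x. x \<in> K \<Longrightarrow> (\<Sum>i\<in>I. (c x i)\<^sup>2) \<le> 1"
  shows "\<exists>\<epsilon>. (\<forall>i\<in>I. \<epsilon> i \<in> {-1, 1}) \<and> (\<forall>x\<in>K. (\<Sum>i\<in>I. \<epsilon> i * c x i) \<le> ln (real (card K)) + 1)"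
proof (cases "K = {}")
  case True
  then show ?thesis by (intro exI[of _ "\<lambda>_. 1"]) auto
next
  case False
  let ?E = "PiE I (\<lambda>_. {-1, 1 :: real})"
  have finE: "finite ?E" using \<open>finite I\<close> by (intro finite_PiE) auto
  have cardE: "card ?E = 2 ^ card I" using \<open>finite I\<close> by (simp add: card_PiE numeral_2_eq_2)
  have neE: "?E \<noteq> {}" by (simp add: PiE_eq_empty_iff)
  have K0: "0 < real (card K)" using False \<open>finite K\<close> by (simp add: card_gt_0_iff)
  have "(\<Sum>\<epsilon>\<in>?E. \<Sum>x\<in>K. exp (\<Sum>i\<in>I. \<epsilon> i * c x i)) = (\<Sum>x\<in>K. \<Sum>\<epsilon>\<in>?E. exp (\<Sum>i\<in>I. \<epsilon> i * c x i))"
    by (rule sum.swap)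
  also have "\<dots> \<le> (\<Sum>x\<in>K. 2 ^ card I * exp 1)"
    by (intro sum_mono sum_signs_exp_le \<open>finite I\<close> c)
  also have "\<dots> = (\<Sum>\<epsilon>\<in>?E. real (card K) * exp 1)" by (simp add: cardE)
  finally have avg: "(\<Sum>\<epsilon>\<in>?E. \<Sum>x\<in>K. exp (\<Sum>i\<in>I. \<epsilon> i * c x i)) \<le> (\<Sum>\<epsilon>\<in>?E. real (card K) * exp 1)" .
  have "\<exists>\<epsilon>\<in>?E. (\<Sum>x\<in>K. exp (\<Sum>i\<in>I. \<epsilon> i * c x i)) \<le> real (card K) * exp 1"
  proof (rule ccontr)
    assume "\<not> ?thesis"
    then have "(\<Sum>\<epsilon>\<in>?E. real (card K) * exp 1) < (\<Sum>\<epsilon>\<in>?E. \<Sum>x\<in>K. exp (\<Sum>i\<in>I. \<epsilon> i * c x i))"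
      using finE neE by (intro sum_strict_mono) auto
    then show False using avg by simp
  qed
  then obtain \<epsilon> where \<epsilon>: "\<epsilon> \<in> ?E" "(\<Sum>x\<in>K. exp (\<Sum>i\<in>I. \<epsilon> i * c x i)) \<le> real (card K) * exp 1"
    by blast
  have "(\<Sum>i\<in>I. \<epsilon> i * c x i) \<le> ln (real (card K)) + 1" if "x \<in> K" for x
  proof -
    have "exp (\<Sum>i\<in>I. \<epsilon> i * c x i) \<le> (\<Sum>x\<in>K. exp (\<Sum>i\<in>I. \<epsilon> i * c x i))"
      using that \<open>finite K\<close> by (intro member_le_sum[where f = "\<lambda>x. exp (\<Sum>i\<in>I. \<epsilon> i * c x i)"]) auto
    also have "\<dots> \<le> exp (ln (real (card K)) + 1)" using \<epsilon>(2) K0 by (simp add: exp_add)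
    finally show ?thesis by simp
  qed
  then show ?thesis using \<epsilon>(1) by (intro exI[of _ \<epsilon>]) (auto simp: PiE_iff)
qed

text \<open>
  Rounding towards zero keeps the rounded point in every ball around the origin that contains the
  given one.
\<close>

lemma round_towards_zero:
  fixes x :: real
  assumes "1 \<le> N" "\<bar>x\<bar> \<le> 1"
  shows "\<exists>i\<in>{- int N..int N}. \<bar>real_of_int i / real N\<bar> \<le> \<bar>x\<bar> \<and> \<bar>x - real_of_int i / real N\<bar> \<le> 1 / real N"
proof -
  have pos: "\<exists>i\<in>{0..int N}. real_of_int i / real N \<le> y \<and> y - real_of_int i / real N \<le> 1 / real N"
    if "0 \<le> y" "y \<le> 1" for y :: real
  proof (intro bexI conjI)
    have "real N * y \<le> real N" using that by (simp add: mult_left_le)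
    then have "\<lfloor>real N * y\<rfloor> \<le> \<lfloor>real N\<rfloor>" by (rule floor_mono)
    then show "\<lfloor>real N * y\<rfloor> \<in> {0..int N}" using that by simp
    show "real_of_int \<lfloor>real N * y\<rfloor> / real N \<le> y"
      using \<open>1 \<le> N\<close> by (simp add: divide_le_eq mult.commute)
    have "real N * y \<le> real_of_int \<lfloor>real N * y\<rfloor> + 1" by linarith
    then show "y - real_of_int \<lfloor>real N * y\<rfloor> / real N \<le> 1 / real N"
      using divide_right_mono[of "real N * y" _ "real N"] \<open>1 \<le> N\<close>
      by (fastforce simp: add_divide_distrib)
  qed
  show ?thesis
  proof (cases "0 \<le> x")
    case True
    then obtain i where i: "i \<in> {0..int N}" "real_of_int i / real N \<le> x" "x - real_of_int i / real N \<le> 1 / real N"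
      using pos[of x] assms by auto
    have "0 \<le> real_of_int i / real N" using i(1) by simp
    then show ?thesis using i True by (intro bexI[of _ i]) auto
  next
    case False
    then obtain i where i: "i \<in> {0..int N}" "real_of_int i / real N \<le> - x" "- x - real_of_int i / real N \<le> 1 / real N"
      using pos[of "- x"] assms by auto
    have "0 \<le> real_of_int i / real N" using i(1) by simp
    then show ?thesis using i False by (intro bexI[of _ "- i"]) auto
  qed
qed

text \<open>
  All points of mesh \<open>1 / N\<close> in the square with vertices \<open>\<plusminus>1 \<plusminus> \<i>\<close>, which contains the unit disc.
\<close>

definition complex_grid :: "nat \<Rightarrow> complex set" where
  "complex_grid N = (\<lambda>(i, j). Complex (real_of_int i / real N) (real_of_int j / real N))
     ` ({- int N..int N} \<times> {- int N..int N})"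

lemma finite_complex_grid: "finite (complex_grid N)"
  by (simp add: complex_grid_def)

lemma card_complex_grid_le: "card (complex_grid N) \<le> (2 * N + 1)\<^sup>2"
proof -
  have "card (complex_grid N) \<le> card ({- int N..int N} \<times> {- int N..int N})"
    unfolding complex_grid_def by (rule card_image_le) simp
  also have "\<dots> = (2 * N + 1)\<^sup>2"
    by (simp add: card_cartesian_product power2_eq_square nat_add_distrib nat_mult_distrib algebra_simps)
  finally show ?thesis .
qed

lemma complex_grid_approx:
  assumes "1 \<le> N" "cmod z \<le> 1"
  shows "\<exists>w\<in>complex_grid N. cmod w \<le> cmod z \<and> cmod (z - w) \<le> 2 / real N"
proof -
  have "\<bar>Re z\<bar> \<le> 1" "\<bar>Im z\<bar> \<le> 1"
    using abs_Re_le_cmod[of z] abs_Im_le_cmod[of z] assms by auto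
  then obtain i j where i: "i \<in> {- int N..int N}" "\<bar>real_of_int i / real N\<bar> \<le> \<bar>Re z\<bar>"
      "\<bar>Re z - real_of_int i / real N\<bar> \<le> 1 / real N"
    and j: "j \<in> {- int N..int N}" "\<bar>real_of_int j / real N\<bar> \<le> \<bar>Im z\<bar>"
      "\<bar>Im z - real_of_int j / real N\<bar> \<le> 1 / real N"
    using round_towards_zero[OF \<open>1 \<le> N\<close>] by metis
  define w where "w = Complex (real_of_int i / real N) (real_of_int j / real N)"
  have "w \<in> complex_grid N" using i(1) j(1) by (auto simp: w_def complex_grid_def)
  moreover have "cmod w \<le> cmod z"
    unfolding cmod_def w_def using i(2) j(2)
    by (intro real_sqrt_le_mono add_mono) (simp_all only: complex.sel abs_le_square_iff)
  moreover have "cmod (z - w) \<le> 2 / real N"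
    using cmod_le[of "z - w"] i(3) j(3) by (simp add: w_def)
  ultimately show ?thesis by blast
qed

lemma ln_grid_size_le:
  assumes "1 \<le> d" "1 \<le> m"
  shows "ln (real (2 * (d * m ^ d) + 1)) \<le> 2 * real (d * m)"
proof -
  have "1 \<le> d * m ^ d" using assms by simp
  then have "real (2 * (d * m ^ d) + 1) \<le> 3 * (real d * real m ^ d)"
    using of_nat_mono[of 1 "d * m ^ d", where 'a = real] by simp
  then have "ln (real (2 * (d * m ^ d) + 1)) \<le> ln (3 * (real d * real m ^ d))"
    by (intro ln_mono) auto
  also have "\<dots> = ln 3 + ln (real d) + real d * ln (real m)"
    using assms by (simp add: ln_mult ln_realpow)
  also have "\<dots> \<le> 2 + (real d - 1) + real d * (real m - 1)"
    using assms ln_le_minus_one[of 3] ln_le_minus_one[of "real d"] ln_le_minus_one[of "real m"]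
    by (intro add_mono mult_left_mono) auto
  also have "\<dots> = 1 + real (d * m)" by (simp add: algebra_simps)
  also have "\<dots> \<le> 2 * real (d * m)"
    using assms of_nat_mono[of 1 "d * m", where 'a = real] by simp
  finally show ?thesis .
qed

text \<open>
  Signs are chosen that make the form small at all points of a net, in the four directions
  \<open>1, -1, \<i>, -\<i>\<close> that control a complex number. For a fixed point of the net the squares of the
  coefficients \<open>\<Prod>\<^sub>k w\<^sub>k\<^sub>,\<^sub>i\<^sub>(\<^sub>k\<^sub>)\<close> sum to a product of squared Euclidean norms, which is at most 1. The mesh
  \<open>1 / (d m\<^sup>d)\<close> is so fine that rounding changes each of the \<open>m\<^sup>d\<close> products by at most \<open>2 / m\<^sup>d\<close>, and hence
  the form by at most 2; nevertheless the logarithm of the size of the net is quadratic in \<open>d m\<close>.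
\<close>

lemma exists_small_sign_tensor:
  fixes d m :: nat
  assumes d: "1 \<le> d" and m: "1 \<le> m"
  defines "I \<equiv> PiE {..<d} (\<lambda>_. {..<m})"
  shows "\<exists>\<epsilon> :: (nat \<Rightarrow> nat) \<Rightarrow> real. (\<forall>i\<in>I. \<bar>\<epsilon> i\<bar> = 1) \<and>
     (\<forall>z :: nat \<Rightarrow> nat \<Rightarrow> complex. (\<forall>k<d. (\<Sum>l<m. (cmod (z k l))\<^sup>2) \<le> 1) \<longrightarrow>
        cmod (\<Sum>i\<in>I. of_real (\<epsilon> i) * (\<Prod>k<d. z k (i k))) \<le> 18 * (real (d * m))\<^sup>2)"
proof -
  have finI: "finite I" unfolding I_def by (intro finite_PiE) auto
  have cardI: "card I = m ^ d" unfolding I_def by (simp add: card_PiE)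
  define N where "N = d * m ^ d"
  have N: "1 \<le> N" using d m by (simp add: N_def)
  define W where "W = {w \<in> PiE ({..<d} \<times> {..<m}) (\<lambda>_. complex_grid N).
      \<forall>k<d. (\<Sum>l<m. (cmod (w (k, l)))\<^sup>2) \<le> 1}"
  define S where "S = {1, -1, \<i>, -\<i>}"
  define P where "P = (\<lambda>(w :: nat \<times> nat \<Rightarrow> complex) (i :: nat \<Rightarrow> nat). \<Prod>k<d. w (k, i k))"
  define c where "c = (\<lambda>x i. Re (snd x * P (fst x) i))"
  have finW': "finite (PiE ({..<d} \<times> {..<m}) (\<lambda>_. complex_grid N))"
    by (intro finite_PiE) (auto simp: finite_complex_grid)
  then have finW: "finite W" by (rule finite_subset[rotated]) (auto simp: W_def)
  have finK: "finite (W \<times> S)" using finW by (simp add: S_def)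
  have l2: "(\<Sum>i\<in>I. (c x i)\<^sup>2) \<le> 1" if xWS: "x \<in> W \<times> S" for x
  proof -
    obtain w s where x: "x = (w, s)" "w \<in> W" "s \<in> S" using xWS by blast
    have "cmod s = 1" using x(3) by (auto simp: S_def)
    have "(\<Sum>i\<in>I. (c x i)\<^sup>2) \<le> (\<Sum>i\<in>I. (cmod (P w i))\<^sup>2)"
    proof (rule sum_mono)
      fix i
      have "\<bar>c x i\<bar> \<le> cmod (s * P w i)" unfolding c_def x(1) fst_conv snd_conv by (rule abs_Re_le_cmod)
      then show "(c x i)\<^sup>2 \<le> (cmod (P w i))\<^sup>2"
        using \<open>cmod s = 1\<close> by (simp add: norm_mult abs_le_square_iff[symmetric])
    qed
    also have "\<dots> = (\<Sum>i\<in>I. \<Prod>k<d. (cmod (w (k, i k)))\<^sup>2)"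
      by (simp add: P_def prod_power_distrib flip: prod_norm)
    also have "\<dots> = (\<Prod>k<d. \<Sum>l<m. (cmod (w (k, l)))\<^sup>2)"
      unfolding I_def by (rule prod_sum_PiE[symmetric]) auto
    also have "\<dots> \<le> (\<Prod>k<d. 1)"
      using x(2) by (intro prod_mono) (auto simp: W_def intro: sum_nonneg)
    finally show ?thesis by simp
  qed
  have "\<exists>\<epsilon>. (\<forall>i\<in>I. \<epsilon> i \<in> {-1, 1}) \<and>
      (\<forall>x\<in>W \<times> S. (\<Sum>i\<in>I. \<epsilon> i * c x i) \<le> ln (real (card (W \<times> S))) + 1)"
    by (rule exists_signs_all_sums_small[OF finI finK l2])
  then obtain \<epsilon> where \<epsilon>: "\<forall>i\<in>I. \<epsilon> i \<in> {-1, 1}"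
      and small: "\<forall>x\<in>W \<times> S. (\<Sum>i\<in>I. \<epsilon> i * c x i) \<le> ln (real (card (W \<times> S))) + 1"
    by (elim exE conjE) (rule that)
  have \<epsilon>1: "\<bar>\<epsilon> i\<bar> = 1" if "i \<in> I" for i using bspec[OF \<epsilon> that] by auto
  have dm: "1 \<le> real (d * m)" using d m of_nat_mono[of 1 "d * m", where 'a = real] by simp
  have ln_card: "ln (real (card (W \<times> S))) + 1 \<le> 8 * (real (d * m))\<^sup>2"
  proof (cases "W = {}")
    case True
    then show ?thesis using one_le_power[OF dm, of 2] by simp
  next
    case False
    have "card W \<le> card (PiE ({..<d} \<times> {..<m}) (\<lambda>_. complex_grid N))"
      using finW' by (intro card_mono) (auto simp: W_def)
    also have "\<dots> = card (complex_grid N) ^ (d * m)" by (simp add: card_PiE)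
    also have "\<dots> \<le> ((2 * N + 1)\<^sup>2) ^ (d * m)" by (intro power_mono card_complex_grid_le) auto
    also have "\<dots> = (2 * N + 1) ^ (2 * (d * m))" by (simp add: power_mult)
    finally have cW: "card W \<le> (2 * N + 1) ^ (2 * (d * m))" .
    have "S = set [1, -1, \<i>, -\<i>]" by (simp add: S_def)
    then have "card S \<le> length [1, -1, \<i>, -\<i>]" by (simp only: card_length)
    then have "card S \<le> 4" by simp
    then have "card (W \<times> S) \<le> (2 * N + 1) ^ (2 * (d * m)) * 4"
      unfolding card_cartesian_product by (intro mult_le_mono cW)
    then have "real (card (W \<times> S)) \<le> real ((2 * N + 1) ^ (2 * (d * m)) * 4)"
      by (rule of_nat_mono)
    also have "\<dots> = real (2 * N + 1) ^ (2 * (d * m)) * 4" by simp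
    finally have "ln (real (card (W \<times> S))) \<le> ln (real (2 * N + 1) ^ (2 * (d * m)) * 4)"
      using False finW by (intro ln_mono) (auto simp: card_gt_0_iff S_def)
    also have "\<dots> = real (2 * (d * m)) * ln (real (2 * N + 1)) + ln 4"
      by (subst ln_mult) (auto simp only: ln_realpow zero_less_power of_nat_0_less_iff, auto)
    also have "\<dots> \<le> real (2 * (d * m)) * (2 * real (d * m)) + 3"
      using ln_grid_size_le[OF d m] ln_le_minus_one[of 4] unfolding N_def
      by (intro add_mono mult_left_mono) auto
    also have "\<dots> = 4 * (real (d * m))\<^sup>2 + 3" by (simp add: power2_eq_square)
    finally have "ln (real (card (W \<times> S))) + 1 \<le> 4 * (real (d * m))\<^sup>2 + 4" by simp
    moreover have "1 \<le> (real (d * m))\<^sup>2" using dm by (rule one_le_power)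
    ultimately show ?thesis by linarith
  qed
  have net: "cmod (\<Sum>i\<in>I. of_real (\<epsilon> i) * P w i) \<le> 16 * (real (d * m))\<^sup>2" if "w \<in> W" for w
  proof -
    let ?A = "\<Sum>i\<in>I. of_real (\<epsilon> i) * P w i"
    have "Re (s * ?A) \<le> 8 * (real (d * m))\<^sup>2" if "s \<in> S" for s
    proof -
      have "s * ?A = (\<Sum>i\<in>I. of_real (\<epsilon> i) * (s * P w i))"
        unfolding sum_distrib_left by (simp add: mult_ac)
      then have "Re (s * ?A) = (\<Sum>i\<in>I. \<epsilon> i * c (w, s) i)"
        by (simp add: c_def)
      also have "\<dots> \<le> ln (real (card (W \<times> S))) + 1" using small \<open>w \<in> W\<close> that by blast
      finally show ?thesis using ln_card by linarith
    qed
    from this[of 1] this[of "-1"] this[of \<i>] this[of "-\<i>"]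
    have "\<bar>Re ?A\<bar> \<le> 8 * (real (d * m))\<^sup>2" "\<bar>Im ?A\<bar> \<le> 8 * (real (d * m))\<^sup>2"
      by (auto simp: S_def abs_le_iff)
    then show ?thesis using cmod_le[of ?A] by linarith
  qed
  have "cmod (\<Sum>i\<in>I. of_real (\<epsilon> i) * (\<Prod>k<d. z k (i k))) \<le> 18 * (real (d * m))\<^sup>2"
    if z: "\<forall>k<d. (\<Sum>l<m. (cmod (z k l))\<^sup>2) \<le> 1" for z :: "nat \<Rightarrow> nat \<Rightarrow> complex"
  proof -
    have z1: "cmod (z k l) \<le> 1" if "k < d" "l < m" for k l
    proof -
      have "(cmod (z k l))\<^sup>2 \<le> (\<Sum>l<m. (cmod (z k l))\<^sup>2)"
        using that by (intro member_le_sum) auto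
      then have "(cmod (z k l))\<^sup>2 \<le> 1" using z that by force
      then show ?thesis by (simp add: power_le_one_iff abs_square_le_1)
    qed
    have "\<exists>w. \<forall>k l. k < d \<longrightarrow> l < m \<longrightarrow>
        w (k, l) \<in> complex_grid N \<and> cmod (w (k, l)) \<le> cmod (z k l) \<and> cmod (z k l - w (k, l)) \<le> 2 / real N"
    proof -
      have "\<forall>x. \<exists>w. fst x < d \<longrightarrow> snd x < m \<longrightarrow>
          w \<in> complex_grid N \<and> cmod w \<le> cmod (z (fst x) (snd x)) \<and> cmod (z (fst x) (snd x) - w) \<le> 2 / real N"
        using complex_grid_approx[OF N z1] by blast
      then obtain w where "\<forall>x. fst x < d \<longrightarrow> snd x < m \<longrightarrow>
          w x \<in> complex_grid N \<and> cmod (w x) \<le> cmod (z (fst x) (snd x)) \<and> cmod (z (fst x) (snd x) - w x) \<le> 2 / real N"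
        by metis
      then show ?thesis by (intro exI[of _ w]) auto
    qed
    then obtain w0 where w0: "\<And>k l. k < d \<Longrightarrow> l < m \<Longrightarrow>
        w0 (k, l) \<in> complex_grid N \<and> cmod (w0 (k, l)) \<le> cmod (z k l) \<and> cmod (z k l - w0 (k, l)) \<le> 2 / real N"
      by blast
    define w where "w = restrict w0 ({..<d} \<times> {..<m})"
    have w: "w (k, l) \<in> complex_grid N" "cmod (w (k, l)) \<le> cmod (z k l)" "cmod (z k l - w (k, l)) \<le> 2 / real N"
      if "k < d" "l < m" for k l using w0[OF that] that by (auto simp: w_def)
    have "w \<in> W"
    proof -
      have "(\<Sum>l<m. (cmod (w (k, l)))\<^sup>2) \<le> 1" if "k < d" for k
      proof -
        have "(\<Sum>l<m. (cmod (w (k, l)))\<^sup>2) \<le> (\<Sum>l<m. (cmod (z k l))\<^sup>2)"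
          using w(2) that by (intro sum_mono power_mono) auto
        then show ?thesis using z that by force
      qed
      moreover have "w \<in> PiE ({..<d} \<times> {..<m}) (\<lambda>_. complex_grid N)"
        using w0 by (auto simp: w_def)
      ultimately show ?thesis by (simp add: W_def)
    qed
    have diff: "cmod ((\<Prod>k<d. z k (i k)) - P w i) \<le> real d * (2 / real N)" if "i \<in> I" for i
    proof -
      have il: "i k < m" if "k < d" for k using \<open>i \<in> I\<close> that by (auto simp: I_def PiE_iff)
      have "cmod ((\<Prod>k<d. z k (i k)) - (\<Prod>k<d. w (k, i k))) \<le> (\<Sum>k<d. cmod (z k (i k) - w (k, i k)))"
        using z1 il order_trans[OF w(2) z1] by (intro norm_prod_diff) auto
      also have "\<dots> \<le> (\<Sum>k<d. 2 / real N)" using w(3) il by (intro sum_mono) auto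
      finally show ?thesis by (simp add: P_def)
    qed
    have "cmod ((\<Sum>i\<in>I. of_real (\<epsilon> i) * (\<Prod>k<d. z k (i k))) - (\<Sum>i\<in>I. of_real (\<epsilon> i) * P w i))
        = cmod (\<Sum>i\<in>I. of_real (\<epsilon> i) * ((\<Prod>k<d. z k (i k)) - P w i))"
      by (simp add: sum_subtractf right_diff_distrib)
    also have "\<dots> \<le> (\<Sum>i\<in>I. cmod (of_real (\<epsilon> i) * ((\<Prod>k<d. z k (i k)) - P w i)))" by (rule norm_sum)
    also have "\<dots> \<le> (\<Sum>i\<in>I. real d * (2 / real N))"
      using diff \<epsilon>1 by (intro sum_mono) (simp add: norm_mult)
    also have "\<dots> = 2" using d m by (simp add: cardI N_def)
    finally have "cmod ((\<Sum>i\<in>I. of_real (\<epsilon> i) * (\<Prod>k<d. z k (i k))) - (\<Sum>i\<in>I. of_real (\<epsilon> i) * P w i)) \<le> 2" .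
    moreover have "1 \<le> (real (d * m))\<^sup>2" using dm by (rule one_le_power)
    ultimately show ?thesis
      using net[OF \<open>w \<in> W\<close>] norm_triangle_sub[of "\<Sum>i\<in>I. of_real (\<epsilon> i) * (\<Prod>k<d. z k (i k))" "\<Sum>i\<in>I. of_real (\<epsilon> i) * P w i"]
      by linarith
  qed
  then show ?thesis using \<epsilon>1 by blast
qed

section \<open>Block polynomials and the upper bound\<close>

lemma prod_root_le_mean_power:
  fixes s :: "nat \<Rightarrow> real"
  assumes "1 \<le> d" "0 < q" and s: "\<And>k. k < d \<Longrightarrow> 0 \<le> s k" and sum: "(\<Sum>k<d. s k) \<le> S"
  shows "(\<Prod>k<d. s k powr (1 / q)) \<le> ((S / real d) powr (1 / q)) ^ d"
proof -
  have "(\<Prod>k<d. s k) powr (1 / real d) \<le> (\<Sum>k<d. s k / real d)"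
    using arith_geom_mean[of "{..<d}" s] assms by (auto simp: lessThan_empty_iff)
  also have "\<dots> \<le> S / real d"
    using sum by (simp add: divide_right_mono flip: sum_divide_distrib)
  finally have le: "(\<Prod>k<d. s k) powr (1 / real d) \<le> S / real d" .
  have "(\<Prod>k<d. s k powr (1 / q)) = (\<Prod>k<d. s k) powr (1 / q)"
    using s by (subst prod_powr_distrib) auto
  also have "\<dots> = ((\<Prod>k<d. s k) powr (1 / real d)) powr (real d * (1 / q))"
    using \<open>1 \<le> d\<close> by (simp add: powr_powr)
  also have "\<dots> \<le> (S / real d) powr (real d * (1 / q))"
    using le \<open>0 < q\<close> by (intro powr_mono2) auto
  also have "\<dots> = ((S / real d) powr (1 / q)) ^ d"
    using \<open>1 \<le> d\<close> by (cases "S = 0") (auto simp: powr_power mult.commute)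
  finally show ?thesis .
qed

text \<open>
  Each block is divided by its \<open>\<ell>\<^sub>q\<close> norm. A vector with \<open>\<ell>\<^sub>q\<close> norm 1 has coordinates of modulus at most
  1, hence Euclidean norm at most 1 because \<open>q \<le> 2\<close>. The product of the \<open>\<ell>\<^sub>q\<close> norms of the blocks is largest
  when they are equal.
\<close>

lemma tensor_bound_lq:
  fixes z :: "nat \<Rightarrow> nat \<Rightarrow> complex" and d m :: nat
  defines "I \<equiv> PiE {..<d} (\<lambda>_. {..<m})"
  assumes d: "1 \<le> d" and q: "1 \<le> q" "q \<le> 2" and T: "0 \<le> T"
    and tensor: "\<And>w :: nat \<Rightarrow> nat \<Rightarrow> complex. (\<forall>k<d. (\<Sum>l<m. (cmod (w k l))\<^sup>2) \<le> 1) \<Longrightarrow>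
        cmod (\<Sum>i\<in>I. of_real (\<epsilon> i) * (\<Prod>k<d. w k (i k))) \<le> T"
    and sum: "(\<Sum>k<d. \<Sum>l<m. cmod (z k l) powr q) \<le> S"
  shows "cmod (\<Sum>i\<in>I. of_real (\<epsilon> i) * (\<Prod>k<d. z k (i k))) \<le> T * ((S / real d) powr (1 / q)) ^ d"
proof -
  define s where "s = (\<lambda>k. \<Sum>l<m. cmod (z k l) powr q)"
  have s0: "0 \<le> s k" for k unfolding s_def by (intro sum_nonneg) auto
  have amgm: "(\<Prod>k<d. s k powr (1 / q)) \<le> ((S / real d) powr (1 / q)) ^ d"
    using d q s0 sum by (intro prod_root_le_mean_power) (auto simp: s_def)
  have "cmod (\<Sum>i\<in>I. of_real (\<epsilon> i) * (\<Prod>k<d. z k (i k))) \<le> T * (\<Prod>k<d. s k powr (1 / q))"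
  proof (cases "\<exists>k<d. s k = 0")
    case True
    then obtain k where k: "k < d" "s k = 0" by blast
    have "z k l = 0" if "l < m" for l
    proof -
      have "cmod (z k l) powr q \<le> s k"
        unfolding s_def using that by (intro member_le_sum) auto
      then show ?thesis using k by simp
    qed
    then have "(\<Prod>k<d. z k (i k)) = 0" if "i \<in> I" for i
      using k(1) that by (intro prod_zero) (auto simp: I_def PiE_iff)
    then have "(\<Sum>i\<in>I. of_real (\<epsilon> i) * (\<Prod>k<d. z k (i k))) = 0" by (intro sum.neutral) auto
    then show ?thesis using T by (simp add: prod_nonneg)
  next
    case False
    then have pos: "0 < s k" if "k < d" for k using s0[of k] that by (metis order_le_imp_less_or_eq)
    define w where "w = (\<lambda>k l. z k l / of_real (s k powr (1 / q)))"
    have "(\<Sum>l<m. (cmod (w k l))\<^sup>2) \<le> 1" if k: "k < d" for k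
    proof -
      have wq: "cmod (w k l) powr q = cmod (z k l) powr q / s k" for l
        using pos[OF k] q by (simp add: w_def norm_divide powr_divide powr_powr)
      have le1: "cmod (w k l) powr q \<le> 1" if "l < m" for l
      proof -
        have "cmod (z k l) powr q \<le> s k" unfolding s_def using that by (intro member_le_sum) auto
        then show ?thesis using pos[OF k] by (simp add: wq)
      qed
      have "(cmod (w k l))\<^sup>2 \<le> cmod (w k l) powr q" if "l < m" for l
      proof -
        have "cmod (w k l) \<le> 1"
        proof (rule ccontr)
          assume "\<not> cmod (w k l) \<le> 1"
          then have "1 powr q < cmod (w k l) powr q" using q by (intro powr_less_mono2) auto
          then show False using le1[OF that] by simp
        qed
        then have "cmod (w k l) powr 2 \<le> cmod (w k l) powr q"
          using q by (intro powr_mono') auto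
        then show ?thesis by simp
      qed
      then have "(\<Sum>l<m. (cmod (w k l))\<^sup>2) \<le> (\<Sum>l<m. cmod (z k l) powr q / s k)"
        unfolding wq[symmetric] by (intro sum_mono) auto
      also have "\<dots> = 1" using pos[OF k] by (simp add: s_def flip: sum_divide_distrib)
      finally show ?thesis .
    qed
    then have le: "cmod (\<Sum>i\<in>I. of_real (\<epsilon> i) * (\<Prod>k<d. w k (i k))) \<le> T" by (intro tensor) auto
    have "(\<Prod>k<d. z k (i k)) = of_real (\<Prod>k<d. s k powr (1 / q)) * (\<Prod>k<d. w k (i k))" for i
      unfolding of_real_prod prod.distrib[symmetric] w_def
      using pos by (intro prod.cong) (auto simp: less_imp_neq[symmetric])
    then have "(\<Sum>i\<in>I. of_real (\<epsilon> i) * (\<Prod>k<d. z k (i k)))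
        = of_real (\<Prod>k<d. s k powr (1 / q)) * (\<Sum>i\<in>I. of_real (\<epsilon> i) * (\<Prod>k<d. w k (i k)))"
      by (simp add: sum_distrib_left mult_ac)
    then have "cmod (\<Sum>i\<in>I. of_real (\<epsilon> i) * (\<Prod>k<d. z k (i k)))
        = (\<Prod>k<d. s k powr (1 / q)) * cmod (\<Sum>i\<in>I. of_real (\<epsilon> i) * (\<Prod>k<d. w k (i k)))"
      by (simp add: norm_mult abs_of_nonneg prod_nonneg flip: prod_norm)
    also have "\<dots> \<le> (\<Prod>k<d. s k powr (1 / q)) * T"
      using le by (intro mult_left_mono prod_nonneg) auto
    finally show ?thesis by (simp add: mult.commute)
  qed
  also have "\<dots> \<le> T * ((S / real d) powr (1 / q)) ^ d" using amgm T by (rule mult_left_mono)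
  finally show ?thesis .
qed

text \<open>
  The exponent of the monomial \<open>z\<^bsub>i\<^sub>0\<^esub> z\<^bsub>m+i\<^sub>1\<^esub> \<cdots> z\<^bsub>(d-1)m+i\<^bsub>d-1\<^esub>\<^esub>\<close>: block \<open>k\<close> consists of the coordinates from \<open>k m\<close> to
  \<open>k m + m - 1\<close>.
\<close>

definition block_index :: "nat \<Rightarrow> nat \<Rightarrow> (nat \<Rightarrow> nat) \<Rightarrow> nat \<Rightarrow> nat" where
  "block_index d m i = (\<lambda>j. if j \<in> (\<lambda>k. k * m + i k) ` {..<d} then 1 else 0)"

context
  fixes d m n :: nat and I :: "(nat \<Rightarrow> nat) set"
  assumes m: "1 \<le> m" and dm: "d * m \<le> n"
  defines "I \<equiv> PiE {..<d} (\<lambda>_. {..<m})"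
begin

lemma block_entry:
  assumes "i \<in> I" "k < d"
  shows "k * m + i k < d * m" "(k * m + i k) div m = k" "(k * m + i k) mod m = i k"
proof -
  have i: "i k < m" using assms by (auto simp: I_def PiE_iff)
  then show "(k * m + i k) div m = k" "(k * m + i k) mod m = i k" by auto
  have "k * m + i k < Suc k * m" using i by simp
  also have "\<dots> \<le> d * m" using \<open>k < d\<close> by (intro mult_le_mono1) auto
  finally show "k * m + i k < d * m" .
qed

lemma inj_on_block_entry: "i \<in> I \<Longrightarrow> inj_on (\<lambda>k. k * m + i k) {..<d}"
  by (rule inj_onI) (metis block_entry(2) lessThan_iff)

lemma block_entries_subset: "i \<in> I \<Longrightarrow> (\<lambda>k. k * m + i k) ` {..<d} \<subseteq> {..<n}"
  using block_entry(1) dm by fastforce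

lemma block_index_in: "i \<in> I \<Longrightarrow> block_index d m i \<in> multi_indices n"
  using block_entries_subset by (fastforce simp: block_index_def multi_indices_def)

lemma block_index_degree:
  assumes "i \<in> I"
  shows "mi_degree n (block_index d m i) = d"
proof -
  have "mi_degree n (block_index d m i) = (\<Sum>j\<in>(\<lambda>k. k * m + i k) ` {..<d}. 1)"
    unfolding mi_degree_def block_index_def using block_entries_subset[OF assms]
    by (intro sum.mono_neutral_cong_right) auto
  also have "\<dots> = d" by (simp add: card_image inj_on_block_entry[OF assms])
  finally show ?thesis .
qed

lemma mi_power_block_index:
  assumes "i \<in> I"
  shows "mi_power n z (block_index d m i) = (\<Prod>k<d. z (k * m + i k))"
proof -
  have "mi_power n z (block_index d m i) = (\<Prod>j\<in>(\<lambda>k. k * m + i k) ` {..<d}. z j)"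
    unfolding mi_power_def block_index_def using block_entries_subset[OF assms]
    by (intro prod.mono_neutral_cong_right) auto
  also have "\<dots> = (\<Prod>k<d. z (k * m + i k))"
    by (simp add: prod.reindex inj_on_block_entry[OF assms])
  finally show ?thesis .
qed

lemma inj_on_block_index: "inj_on (block_index d m) I"
proof (rule inj_onI)
  fix i i' assume i: "i \<in> I" and i': "i' \<in> I" and eq: "block_index d m i = block_index d m i'"
  show "i = i'"
  proof (rule PiE_ext[OF i[unfolded I_def] i'[unfolded I_def]])
    fix k assume "k \<in> {..<d}"
    then have k: "k < d" by simp
    have "block_index d m i' (k * m + i k) = 1"
      unfolding eq[symmetric] using k by (auto simp: block_index_def)
    then obtain k' where k': "k' < d" "k * m + i k = k' * m + i' k'"
      by (auto simp: block_index_def split: if_splits)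
    then show "i k = i' k" using block_entry[OF i k] block_entry[OF i' k'(1)] by metis
  qed
qed

end

lemma sum_over_blocks:
  fixes g :: "nat \<Rightarrow> 'a :: comm_monoid_add"
  shows "(\<Sum>k<d. \<Sum>l<m. g (k * m + l)) = (\<Sum>j<d * m. g j)"
proof -
  have "(\<Sum>l<m. g (k * m + l)) = (\<Sum>j = k * m..<k * m + m. g j)" for k
    by (rule sum.reindex_bij_witness[where i = "\<lambda>j. j - k * m" and j = "\<lambda>l. k * m + l"]) auto
  then show ?thesis by (simp add: sum.nat_group)
qed

text \<open>
  The Bohr property is applied to the block polynomial divided by its bound \<open>M\<close> on the unit ball, at
  the point \<open>t n\<^bsup>-1/p\<^esup> (1, \<dots>, 1)\<close> of norm \<open>t\<close>. The dependence on \<open>p\<close> other than through \<open>q\<close> cancels.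
\<close>

lemma bohr_property_power_bound:
  assumes p: "1 \<le> p" and d: "1 \<le> d" and m: "1 \<le> m" and dm: "d * m \<le> n"
    and bohr: "bohr_property n p \<rho>" and t: "0 < t" "t < \<rho>"
  defines "q \<equiv> real_of_ereal (min p 2)"
  shows "t ^ d \<le> 18 * (real (d * m))\<^sup>2 * ((real n / real d) powr (1 / q) / real m) ^ d"
proof -
  define P where "P = real_of_ereal p"
  have q: "1 \<le> q" "q \<le> 2"
    using p by (cases p; auto simp: q_def min_def)+
  have n1: "1 \<le> n" using d m dm by (metis mult_le_mono nat_mult_1 order_trans)
  define I where "I = PiE {..<d} (\<lambda>_. {..<m})"
  have finI: "finite I" unfolding I_def by (intro finite_PiE) auto
  define T where "T = 18 * (real (d * m))\<^sup>2"
  have T: "0 < T" using d m by (simp add: T_def)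
  obtain \<epsilon> :: "(nat \<Rightarrow> nat) \<Rightarrow> real" where \<epsilon>: "\<And>i. i \<in> I \<Longrightarrow> \<bar>\<epsilon> i\<bar> = 1"
    and tensor: "\<And>z :: nat \<Rightarrow> nat \<Rightarrow> complex. (\<forall>k<d. (\<Sum>l<m. (cmod (z k l))\<^sup>2) \<le> 1) \<Longrightarrow>
        cmod (\<Sum>i\<in>I. of_real (\<epsilon> i) * (\<Prod>k<d. z k (i k))) \<le> T"
    using exists_small_sign_tensor[OF d m] unfolding I_def T_def by blast
  define M where "M = T * ((real n powr (1 - q / P) / real d) powr (1 / q)) ^ d"
  have M: "0 < M" using T n1 d by (simp add: M_def)
  let ?\<alpha> = "block_index d m"
  note \<alpha> = block_index_in[OF m dm, folded I_def] block_index_degree[OF m dm, folded I_def]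
    mi_power_block_index[OF m dm, folded I_def] inj_on_block_index[OF m dm, folded I_def]
  define c where "c = (\<lambda>i. complex_of_real (\<epsilon> i / M))"
  have cmod_c: "cmod (c i) = 1 / M" if "i \<in> I" for i
    using \<epsilon>[OF that] M unfolding c_def norm_of_real by simp
  define f where "f = (\<lambda>z. \<Sum>i\<in>I. c i * mi_power n z (?\<alpha> i))"
  define a where "a = (\<lambda>\<beta>. if \<beta> \<in> ?\<alpha> ` I then c (inv_into I ?\<alpha> \<beta>) else 0)"
  define b where "b = (\<lambda>_ :: nat \<Rightarrow> nat. 0 :: complex)"
  have a: "a (?\<alpha> i) = c i" if "i \<in> I" for i
    using that \<alpha>(4) by (simp add: a_def inv_into_f_f)
  have "pluriharmonic_on n (lp_ball n p 1) f"
    unfolding f_def by (rule pluriharmonic_on_polynomial)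
  moreover have "has_expansion_on n (lp_ball n p 1) f a b"
  proof -
    have "((\<lambda>\<beta>. a \<beta> * mi_power n z \<beta>) has_sum f z) (multi_indices n)" for z
    proof (rule has_sum_finite_neutralI)
      show "finite (?\<alpha> ` I)" using finI by simp
      show "?\<alpha> ` I \<subseteq> multi_indices n" using \<alpha>(1) by auto
      show "f z = (\<Sum>\<beta>\<in>?\<alpha> ` I. a \<beta> * mi_power n z \<beta>)"
        by (simp add: f_def sum.reindex[OF \<alpha>(4)] a)
    qed (simp add: a_def)
    then show ?thesis unfolding has_expansion_on_def b_def
      by (auto simp: has_sum_iff)
  qed
  moreover have "b (\<lambda>_. 0) = 0" by (simp add: b_def)
  moreover have "cmod (f z) \<le> 1" if z: "z \<in> lp_ball n p 1" for z
  proof -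
    have "(\<Sum>k<d. \<Sum>l<m. cmod (z (k * m + l)) powr q) = (\<Sum>j<d * m. cmod (z j) powr q)"
      by (rule sum_over_blocks)
    also have "\<dots> \<le> (\<Sum>j<n. cmod (z j) powr q)" using dm by (intro sum_mono2) auto
    also have "\<dots> \<le> real n powr (1 - q / P)" unfolding q_def P_def by (rule lp_ball_lq_sum[OF p n1 z])
    finally have "cmod (\<Sum>i\<in>I. of_real (\<epsilon> i) * (\<Prod>k<d. z (k * m + i k))) \<le> M"
      unfolding M_def I_def using tensor T
      by (intro tensor_bound_lq[where z = "\<lambda>k l. z (k * m + l)"] d q) (auto simp: I_def)
    moreover have "f z = (\<Sum>i\<in>I. of_real (\<epsilon> i) * (\<Prod>k<d. z (k * m + i k))) / of_real M"
      by (simp add: f_def c_def \<alpha>(3) sum_divide_distrib)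
    ultimately show ?thesis using M by (simp add: norm_divide)
  qed
  moreover define x where "x = t * real n powr - (1 / P)"
  define z where "z = (\<lambda>j. if j < n then complex_of_real x else 0)"
  have x: "0 < x" using t n1 by (simp add: x_def)
  have "z \<in> lp_ball n p \<rho>"
    using lp_norm_constant_vector[OF p n1, of t] t
    unfolding lp_ball_def z_def x_def P_def by (simp add: cspace_def)
  ultimately have sm: "summable (\<lambda>k. bohr_term n a b z (Suc k))"
    and le1: "(\<Sum>k. bohr_term n a b z (Suc k)) \<le> 1"
    using bohr unfolding bohr_property_def by blast+
  \<comment> \<open>The polynomial is homogeneous of degree \<open>d\<close>, so that only this term of the Bohr sum is needed.\<close>
  have "bohr_term n a b z (Suc (d - 1)) \<le> (\<Sum>k. bohr_term n a b z (Suc k))"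
  proof -
    have "0 \<le> bohr_term n a b z (Suc k)" for k by (auto simp: bohr_term_def intro!: sum_nonneg)
    then show ?thesis using sum_le_suminf[OF sm, of "{d - 1}"] by simp
  qed
  then have le: "bohr_term n a b z d \<le> 1" using le1 d by simp
  have "(\<Sum>\<beta>\<in>?\<alpha> ` I. (cmod (a \<beta>) + cmod (b \<beta>)) * cmod (mi_power n z \<beta>)) \<le> bohr_term n a b z d"
    unfolding bohr_term_def using \<alpha>(1,2)
    by (intro sum_mono2 finite_multi_indices_degree) auto
  also have "(\<Sum>\<beta>\<in>?\<alpha> ` I. (cmod (a \<beta>) + cmod (b \<beta>)) * cmod (mi_power n z \<beta>)) = (\<Sum>i\<in>I. 1 / M * x ^ d)"
  proof (subst sum.reindex[OF \<alpha>(4)], rule sum.cong[OF refl])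
    fix i assume i: "i \<in> I"
    have "mi_power n z (?\<alpha> i) = (\<Prod>k<d. complex_of_real x)"
      unfolding \<alpha>(3)[OF i] using block_entry(1)[OF m dm, folded I_def, OF i] dm
      by (intro prod.cong) (auto simp: z_def intro: less_le_trans)
    then show "((\<lambda>\<beta>. (cmod (a \<beta>) + cmod (b \<beta>)) * cmod (mi_power n z \<beta>)) \<circ> ?\<alpha>) i = 1 / M * x ^ d"
      using x by (simp add: a[OF i] b_def cmod_c[OF i] norm_power)
  qed
  also have "\<dots> = real m ^ d * x ^ d / M" by (simp add: I_def card_PiE)
  finally have "real m ^ d * x ^ d / M \<le> 1" using le by (rule order_trans)
  then have "real m ^ d * x ^ d \<le> M" using M by (simp add: field_simps)
  then have "(real m * real n powr - (1 / P)) ^ d * t ^ d \<le> M"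
    by (simp add: x_def power_mult_distrib mult_ac)
  then have "t ^ d \<le> M / (real m * real n powr - (1 / P)) ^ d"
    using m n1 by (subst pos_le_divide_eq) (auto simp: mult.commute)
  also have "\<dots> = T * ((real n powr (1 - q / P) / real d) powr (1 / q) / (real m * real n powr - (1 / P))) ^ d"
    by (simp add: M_def power_divide)
  also have "(real n powr (1 - q / P) / real d) powr (1 / q) / (real m * real n powr - (1 / P))
      = (real n / real d) powr (1 / q) / real m"
  proof -
    have "(1 - q / P) * (1 / q) = 1 / q - 1 / P" using q by (simp add: field_simps)
    then have "(real n powr (1 - q / P) / real d) powr (1 / q) = real n powr (1 / q - 1 / P) / real d powr (1 / q)"
      by (simp only: powr_divide powr_powr)
    then show ?thesis using n1 d by (simp add: powr_divide powr_diff powr_minus_divide)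
  qed
  finally show ?thesis by (simp add: T_def)
qed

text \<open>
  The number of blocks is \<open>d = \<lceil>ln n\<rceil>\<close>: large enough for \<open>18 (d m)\<^sup>2 \<le> 18 n\<^sup>2 \<le> (18 e\<^sup>2)\<^sup>d\<close>, and small enough
  for \<open>1 / m \<le> 2 d / n \<le> 5 ln n / n\<close>.
\<close>

lemma bohr_property_upper:
  assumes p: "1 \<le> p" and n: "2 \<le> n" and bohr: "bohr_property n p \<rho>"
  shows "\<rho> \<le> 180 * exp 2 * (ln (real n) / real n) powr (1 - 1 / real_of_ereal (min p 2))"
proof -
  define q where "q = real_of_ereal (min p 2)"
  define \<theta> where "\<theta> = 1 - 1 / q"
  have q: "1 \<le> q" "q \<le> 2"
    using p by (cases p; auto simp: q_def min_def)+
  have \<theta>: "0 \<le> \<theta>" "\<theta> \<le> 1" using q by (auto simp: \<theta>_def)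
  define d where "d = nat \<lceil>ln (real n)\<rceil>"
  define m where "m = n div d"
  have ln_n: "2 / 3 \<le> ln (real n)"
  proof -
    have "ln 2 \<le> ln (real n)" using n by (intro ln_mono) auto
    then show ?thesis using ln2_ge_two_thirds by linarith
  qed
  have d_ge: "ln (real n) \<le> real d" unfolding d_def by linarith
  have d_le: "real d \<le> ln (real n) + 1" unfolding d_def using ln_n by linarith
  have d1: "1 \<le> d" using d_ge ln_n by (cases d) auto
  have "real d \<le> real n" using d_le ln_le_minus_one[of "real n"] n by simp
  then have dn: "d \<le> n" by simp
  have m1: "1 \<le> m" unfolding m_def using dn d1 by (simp add: Suc_le_eq div_greater_zero_iff)
  have dm: "d * m \<le> n" unfolding m_def by simp
  have "n < d * (m + 1)" unfolding m_def using d1 by (simp add: dividend_less_times_div)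
  also have "\<dots> \<le> d * (2 * m)" using m1 by (intro mult_le_mono2) auto
  finally have n_le: "real n \<le> 2 * real d * real m"
    by (metis less_imp_le of_nat_le_iff of_nat_mult of_nat_numeral mult.assoc mult.left_commute)
  have bound: "t \<le> 180 * exp 2 * (ln (real n) / real n) powr \<theta>" if t: "0 < t" "t < \<rho>" for t
  proof -
    have "(real n / real d) powr (1 / q) \<le> (2 * real m) powr (1 / q)"
      using n_le d1 q by (intro powr_mono2) (auto simp: field_simps)
    also have "\<dots> = 2 powr (1 / q) * real m powr (1 / q)" by (simp add: powr_mult)
    also have "\<dots> \<le> 2 powr 1 * real m powr (1 / q)"
      using q by (intro mult_right_mono powr_mono) auto
    finally have "(real n / real d) powr (1 / q) / real m \<le> 2 * real m powr (1 / q) / real m"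
      using m1 by (intro divide_right_mono) auto
    also have "\<dots> = 2 * real m powr - \<theta>"
    proof -
      have "real m powr - \<theta> = real m powr (1 / q - 1)" by (simp add: \<theta>_def)
      then show ?thesis using m1 by (simp add: powr_diff)
    qed
    finally have br: "(real n / real d) powr (1 / q) / real m \<le> 2 * real m powr - \<theta>" .
    have "18 * (real (d * m))\<^sup>2 \<le> 18 ^ d * exp 2 ^ d"
    proof (rule mult_mono)
      show "(18 :: real) \<le> 18 ^ d" using d1 self_le_power[of "18::real" d] by simp
      have "(real (d * m))\<^sup>2 \<le> (real n)\<^sup>2" using dm by (intro power_mono of_nat_mono) auto
      also have "\<dots> = exp (2 * ln (real n))" using n by (simp add: exp_of_nat_mult[of 2, simplified])
      also have "\<dots> \<le> exp (2 * real d)" using d_ge by simp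
      finally show "(real (d * m))\<^sup>2 \<le> exp 2 ^ d" by (simp add: exp_of_nat_mult[symmetric] mult.commute)
    qed auto
    then have "18 * (real (d * m))\<^sup>2 * ((real n / real d) powr (1 / q) / real m) ^ d
        \<le> 18 ^ d * exp 2 ^ d * (2 * real m powr - \<theta>) ^ d"
      by (rule mult_mono[OF _ power_mono[OF br]]) auto
    with bohr_property_power_bound[OF p d1 m1 dm bohr t, folded q_def]
    have "t ^ d \<le> 18 ^ d * exp 2 ^ d * (2 * real m powr - \<theta>) ^ d" by (rule order_trans)
    also have "\<dots> = (18 * exp 2 * (2 * real m powr - \<theta>)) ^ d" by (simp only: power_mult_distrib)
    finally have "t ^ d \<le> (18 * exp 2 * (2 * real m powr - \<theta>)) ^ d" .
    then have "t \<le> 36 * exp 2 * real m powr - \<theta>"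
      using t d1 power_mono_iff[of t "18 * exp 2 * (2 * real m powr - \<theta>)" d] by simp
    also have "real m powr - \<theta> \<le> 5 * (ln (real n) / real n) powr \<theta>"
    proof -
      have "real m powr - \<theta> = (1 / real m) powr \<theta>" by (simp add: powr_minus_divide powr_divide)
      also have "\<dots> \<le> (5 * (ln (real n) / real n)) powr \<theta>"
      proof (rule powr_mono2)
        have "real n \<le> 2 * real d * real m" by (rule n_le)
        also have "\<dots> \<le> 5 * ln (real n) * real m"
          using d_le ln_n by (intro mult_right_mono) auto
        finally show "1 / real m \<le> 5 * (ln (real n) / real n)"
          using m1 n by (simp add: field_simps)
      qed (use \<theta> in auto)
      also have "\<dots> = 5 powr \<theta> * (ln (real n) / real n) powr \<theta>" by (rule powr_mult)
      also have "\<dots> \<le> 5 powr 1 * (ln (real n) / real n) powr \<theta>"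
        using \<theta> by (intro mult_right_mono powr_mono) auto
      finally show ?thesis by simp
    qed
    finally show ?thesis by simp
  qed
  have "\<rho> \<le> 180 * exp 2 * (ln (real n) / real n) powr \<theta>"
  proof (cases "0 < \<rho>")
    case True
    then show ?thesis by (rule dense_le_bounded) (rule bound)
  next
    case False
    then show ?thesis by (meson dual_order.trans linorder_not_less mult_nonneg_nonneg exp_ge_zero powr_ge_zero zero_le_numeral)
  qed
  then show ?thesis by (simp add: \<theta>_def q_def)
qed

section \<open>The Bohr radius\<close>

text \<open>
  The supremum of the admissible radii is admissible, since a point of norm less than the
  supremum lies in the ball of some admissible radius.
\<close>

lemma bohr_radius_between:
  assumes lower: "bohr_property n p \<rho>0" and upper: "\<And>\<rho>. bohr_property n p \<rho> \<Longrightarrow> \<rho> \<le> B"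
  shows "\<rho>0 \<le> bohr_radius n p \<and> bohr_radius n p \<le> B"
proof -
  define R where "R = Sup {\<rho>. bohr_property n p \<rho>}"
  have bdd: "bdd_above {\<rho>. bohr_property n p \<rho>}" using upper by (intro bdd_aboveI[of _ B]) auto
  have R_ge: "\<rho> \<le> R" if "bohr_property n p \<rho>" for \<rho>
    unfolding R_def using bdd that by (intro cSup_upper) auto
  have "bohr_property n p R"
    unfolding bohr_property_def
  proof (intro allI impI ballI)
    fix f a b z
    assume f: "pluriharmonic_on n (lp_ball n p 1) f" "has_expansion_on n (lp_ball n p 1) f a b"
      "b (\<lambda>_. 0) = 0" "\<forall>z\<in>lp_ball n p 1. cmod (f z) \<le> 1" and z: "z \<in> lp_ball n p R"
    then have "lp_norm n p z < Sup {\<rho>. bohr_property n p \<rho>}" by (simp add: lp_ball_def R_def)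
    then obtain \<rho> where \<rho>: "bohr_property n p \<rho>" "lp_norm n p z < \<rho>"
      using less_cSupD[of "{\<rho>. bohr_property n p \<rho>}"] lower by blast
    then have "z \<in> lp_ball n p \<rho>" using z by (simp add: lp_ball_def)
    then show "summable (\<lambda>k. bohr_term n a b z (Suc k)) \<and> (\<Sum>k. bohr_term n a b z (Suc k)) \<le> 1"
      using \<rho>(1) f unfolding bohr_property_def by blast
  qed
  moreover from this have "bohr_radius n p = R"
    unfolding bohr_radius_def using R_ge by (intro Greatest_equality)
  ultimately show ?thesis using R_ge[OF lower] upper by simp
qed

theorem theorem2p11:
  "\<exists>C1 C2 :: real. C1 > 0 \<and> C2 > 0 \<and>
     (\<forall>(p :: ereal) (n :: nat). 1 \<le> p \<longrightarrow> 2 \<le> n \<longrightarrow>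
        C1 * (1 / real n) powr (1 - 1 / real_of_ereal (min p 2)) \<le> bohr_radius n p \<and>
        bohr_radius n p \<le> C2 * (ln (real n) / real n) powr (1 - 1 / real_of_ereal (min p 2)))"
proof (intro exI conjI allI impI)
  show "(0 :: real) < 1 / 18" "(0 :: real) < 180 * exp 2" by auto
  fix p :: ereal and n :: nat
  assume "1 \<le> p" "2 \<le> n"
  then have "1 / 18 * (1 / real n) powr (1 - 1 / real_of_ereal (min p 2)) \<le> bohr_radius n p \<and>
      bohr_radius n p \<le> 180 * exp 2 * (ln (real n) / real n) powr (1 - 1 / real_of_ereal (min p 2))"
    by (intro bohr_radius_between bohr_property_lower bohr_property_upper) auto
  then show "1 / 18 * (1 / real n) powr (1 - 1 / real_of_ereal (min p 2)) \<le> bohr_radius n p"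
    "bohr_radius n p \<le> 180 * exp 2 * (ln (real n) / real n) powr (1 - 1 / real_of_ereal (min p 2))"
    by auto
qed

end
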